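(* Let $\mathcal T$ be a balanced staged tree. Then the associated monomial algebra $A_{\mathcal T}$, i.e. the subalgebra of $\mathbb R[\Theta,z]$ generated by the monomials $z^{d-d(\lambda_r)}\prod_{e\in E(\lambda_r)}\theta(e)$, $r=1,\dots,n$, is Koszul.
   Context: A staged tree $\mathcal T$ is a finite rooted tree, edges directed away from the root, with an equivalence relation $\sim$ on vertices (classes are called stages or colours) and edge labels $\theta(e)$ such that: the outgoing edges of an inner vertex have pairwise distinct labels; inner vertices in the same stage have the same set of outgoing edge labels; inner vertices in different stages have disjoint sets of outgoing labels; leaves are (by convention) all in the same stage. Labels stand for probabilities in $(0,1)$ summing to one at each inner vertex, so each inner vertex has at least two children. The children of a vertex $v$ are written $v_1,\dots,v_k$, ordered such that if $u\sim v$ is a stage with labels $\theta_1,\dots,\theta_k$, then the edges $(u,u_i)$ and $(v,v_i)$ both have label $\theta_i$. $\lambda_1,\dots,\lambda_n$ are the root-to-leaf paths, $E(\lambda_r)$ is the set of edges of $\lambda_r$, $d(\lambda_r)=|E(\lambda_r)|$, and $d=\max_r d(\lambda_r)$. The set $\Theta$ of labels is treated as a set of variables and $z$ is one extra variable. For a vertex $v$, $t(v)\in\mathbb R[\Theta]$ is the sum over all $v$-to-leaf paths of the product of the labels along the path ($t(v)=1$ for a leaf). $\mathcal T$ is balanced if for any two vertices $u\sim v$ in the same stage, $t(u_i)t(v_j)=t(u_j)t(v_i)$ in $\mathbb R[\Theta]$ for all $i,j=1,\dots,k$. All generators of $A_{\mathcal T}$ have degree $d$; $A_{\mathcal T}$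 is regarded as a standard graded $\mathbb R$-algebra with these generators in degree one. A standard graded $K$-algebra $A$ is Koszul if $K$ has a linear free resolution over $A$. *)

theory Defs
  imports Complex_Main "HOL-Library.Poly_Mapping" "Graph_Theory.Graph_Theory"
begin

text \<open>
  Polynomials in variables \<open>'x\<close> over \<open>\<real>\<close> are elements of
  \<open>('x \<Rightarrow>\<^sub>0 nat) \<Rightarrow>\<^sub>0 real\<close>: finitely supported coefficient functions on the
  exponent vectors \<open>'x \<Rightarrow>\<^sub>0 nat\<close>.
\<close>

instantiation poly_mapping :: (type, real_vector) real_vector
begin

definition scaleR_poly_mapping :: "real \<Rightarrow> ('a \<Rightarrow>\<^sub>0 'b) \<Rightarrow> 'a \<Rightarrow>\<^sub>0 'b" where
  "scaleR_poly_mapping c f = Poly_Mapping.map (scaleR c) f"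

lemma lookup_scaleR_poly_mapping:
  "Poly_Mapping.lookup (c *\<^sub>R f) k = c *\<^sub>R Poly_Mapping.lookup f k"
  by (simp add: scaleR_poly_mapping_def map.rep_eq when_def)

instance
  by standard
    (simp_all add: poly_mapping_eq_iff fun_eq_iff lookup_scaleR_poly_mapping lookup_add
      scaleR_add_right scaleR_add_left)

end

lemma scaleR_poly_mapping_eq_mult:
  fixes f :: "'a::comm_monoid_add \<Rightarrow>\<^sub>0 'b::{comm_ring_1,real_algebra_1}"
  shows "c *\<^sub>R f = Poly_Mapping.single 0 (of_real c) * f"
proof -
  have "c *\<^sub>R f = Poly_Mapping.map ((*) (of_real c)) f"
    by (simp add: poly_mapping_eq_iff fun_eq_iff lookup_scaleR_poly_mapping map.rep_eq when_def
        scaleR_conv_of_real)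
  then show ?thesis
    by (simp add: mult_map_scale_conv_mult)
qed

instance poly_mapping ::
  (comm_monoid_add, "{comm_ring_1,real_algebra_1}") real_algebra_1
  by standard (simp_all add: scaleR_poly_mapping_eq_mult mult.assoc mult.left_commute)


section \<open>Standard graded algebras and the Koszul property\<close>

text \<open>
  Graded \<open>\<real>\<close>-algebras are subalgebras \<open>A\<close> of an ambient commutative \<open>\<real>\<close>-algebra, together
  with the family \<open>G m\<close> of their homogeneous components.
\<close>

definition subalgebra :: "'r::real_algebra_1 set \<Rightarrow> bool" where
  "subalgebra A \<longleftrightarrow> subspace A \<and> 1 \<in> A \<and> (\<forall>x\<in>A. \<forall>y\<in>A. x * y \<in> A)"

definition algebra_generated :: "'r::real_algebra_1 set \<Rightarrow> 'r set" where
  "algebra_generated S = subalgebra hull S"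

definition graded_algebra :: "'r::{comm_ring_1,real_algebra_1} set \<Rightarrow> (nat \<Rightarrow> 'r set) \<Rightarrow> bool" where
  "graded_algebra A G \<longleftrightarrow>
     subalgebra A \<and>
     (\<forall>m. subspace (G m) \<and> G m \<subseteq> A) \<and>
     (\<forall>a\<in>A. \<exists>!g. (\<forall>m. g m \<in> G m) \<and> finite {m. g m \<noteq> 0} \<and> a = (\<Sum>m | g m \<noteq> 0. g m)) \<and>
     (\<forall>m n. \<forall>x\<in>G m. \<forall>y\<in>G n. x * y \<in> G (m + n))"

definition standard_graded :: "'r::{comm_ring_1,real_algebra_1} set \<Rightarrow> (nat \<Rightarrow> 'r set) \<Rightarrow> bool" where
  "standard_graded A G \<longleftrightarrow>
     graded_algebra A G \<and> G 0 = range of_real \<and>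
     (\<exists>B. finite B \<and> G 1 = span B) \<and> A = algebra_generated (G 1)"

text \<open>
  \<open>free_module A b\<close> is \<open>A\<^sup>b\<close>, its elements being padded with zeros beyond \<open>b\<close>.
  \<open>free_component G b s n\<close> is the degree \<open>n\<close> component of
  \<open>A(-s 0) \<oplus> \<dots> \<oplus> A(-s (b - 1))\<close>, whose \<open>j\<close>-th basis vector has degree \<open>s j\<close>.
\<close>

definition free_module :: "'r::zero set \<Rightarrow> nat \<Rightarrow> (nat \<Rightarrow> 'r) set" where
  "free_module A b = {x. (\<forall>j<b. x j \<in> A) \<and> (\<forall>j\<ge>b. x j = 0)}"

definition free_component ::
    "(nat \<Rightarrow> 'r::zero set) \<Rightarrow> nat \<Rightarrow> (nat \<Rightarrow> nat) \<Rightarrow> nat \<Rightarrow> (nat \<Rightarrow> 'r) set" where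
  "free_component G b s n =
     {x. \<forall>j. if j < b \<and> s j \<le> n then x j \<in> G (n - s j) else x j = 0}"

definition graded_hom ::
    "'r::comm_ring_1 set \<Rightarrow> (nat \<Rightarrow> 'r set) \<Rightarrow> nat \<Rightarrow> (nat \<Rightarrow> nat) \<Rightarrow> nat \<Rightarrow> (nat \<Rightarrow> nat)
      \<Rightarrow> ((nat \<Rightarrow> 'r) \<Rightarrow> nat \<Rightarrow> 'r) \<Rightarrow> bool" where
  "graded_hom A G b s c t f \<longleftrightarrow>
     (\<forall>x\<in>free_module A b. f x \<in> free_module A c) \<and>
     (\<forall>x\<in>free_module A b. \<forall>y\<in>free_module A b. f (\<lambda>j. x j + y j) = (\<lambda>j. f x j + f y j)) \<and>
     (\<forall>a\<in>A. \<forall>x\<in>free_module A b. f (\<lambda>j. a * x j) = (\<lambda>j. a * f x j)) \<and>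
     (\<forall>n. \<forall>x\<in>free_component G b s n. f x \<in> free_component G c t n)"

text \<open>
  A graded \<open>A\<close>-linear map from a free module to the residue field \<open>\<real> = A/A\<^sub>+\<close>, which lives in
  degree 0: scalars act by multiplication, components of positive degree act by zero.
\<close>

definition augmentation ::
    "'r::{comm_ring_1,real_algebra_1} set \<Rightarrow> (nat \<Rightarrow> 'r set) \<Rightarrow> nat \<Rightarrow> (nat \<Rightarrow> nat)
      \<Rightarrow> ((nat \<Rightarrow> 'r) \<Rightarrow> real) \<Rightarrow> bool" where
  "augmentation A G b s \<epsilon> \<longleftrightarrow>
     (\<forall>x\<in>free_module A b. \<forall>y\<in>free_module A b. \<epsilon> (\<lambda>j. x j + y j) = \<epsilon> x + \<epsilon> y) \<and>
     (\<forall>c. \<forall>x\<in>free_module A b. \<epsilon> (\<lambda>j. of_real c * x j) = c * \<epsilon> x) \<and>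
     (\<forall>m>0. \<forall>a\<in>G m. \<forall>x\<in>free_module A b. \<epsilon> (\<lambda>j. a * x j) = 0) \<and>
     (\<forall>n>0. \<forall>x\<in>free_component G b s n. \<epsilon> x = 0)"

text \<open>
  Exactness of \<open>\<dots> \<rightarrow> F\<^sub>2 \<rightarrow> F\<^sub>1 \<rightarrow> F\<^sub>0 \<rightarrow> \<real> \<rightarrow> 0\<close>, where \<open>F\<^sub>i\<close> has rank \<open>b i\<close> and basis degrees
  \<open>s i j\<close>, and \<open>\<phi> i\<close> maps \<open>F\<^sub>i\<^sub>+\<^sub>1\<close> to \<open>F\<^sub>i\<close>.
\<close>

definition graded_free_resolution ::
    "'r::{comm_ring_1,real_algebra_1} set \<Rightarrow> (nat \<Rightarrow> 'r set) \<Rightarrow> (nat \<Rightarrow> nat) \<Rightarrow> (nat \<Rightarrow> nat \<Rightarrow> nat)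
      \<Rightarrow> (nat \<Rightarrow> (nat \<Rightarrow> 'r) \<Rightarrow> nat \<Rightarrow> 'r) \<Rightarrow> ((nat \<Rightarrow> 'r) \<Rightarrow> real) \<Rightarrow> bool" where
  "graded_free_resolution A G b s \<phi> \<epsilon> \<longleftrightarrow>
     (\<forall>i. graded_hom A G (b (Suc i)) (s (Suc i)) (b i) (s i) (\<phi> i)) \<and>
     augmentation A G (b 0) (s 0) \<epsilon> \<and>
     \<epsilon> ` free_module A (b 0) = UNIV \<and>
     {x \<in> free_module A (b 0). \<epsilon> x = 0} = \<phi> 0 ` free_module A (b 1) \<and>
     (\<forall>i. {x \<in> free_module A (b (Suc i)). \<phi> i x = (\<lambda>j. 0)} =
            \<phi> (Suc i) ` free_module A (b (Suc (Suc i))))"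

definition has_linear_resolution ::
    "'r::{comm_ring_1,real_algebra_1} set \<Rightarrow> (nat \<Rightarrow> 'r set) \<Rightarrow> bool" where
  "has_linear_resolution A G \<longleftrightarrow>
     (\<exists>b s \<phi> \<epsilon>. graded_free_resolution A G b s \<phi> \<epsilon> \<and> (\<forall>i. \<forall>j<b i. s i j = i))"

definition koszul :: "'r::{comm_ring_1,real_algebra_1} set \<Rightarrow> (nat \<Rightarrow> 'r set) \<Rightarrow> bool" where
  "koszul A G \<longleftrightarrow> standard_graded A G \<and> has_linear_resolution A G"


section \<open>Staged trees\<close>

text \<open>
  \<open>r\<close> is the root, \<open>S\<close> the relation of being in the same stage, \<open>\<theta>\<close> the edge labelling.
  The unique-walk axiom says that the digraph is a tree with edges directed away from the root.
\<close>

locale staged_tree = fin_digraph T for T :: "('v, 'e) pre_digraph" +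
  fixes r :: 'v and S :: "('v \<times> 'v) set" and \<theta> :: "'e \<Rightarrow> 'l"
  assumes root_in_verts: "r \<in> verts T"
    and unique_walk: "\<And>v. v \<in> verts T \<Longrightarrow> \<exists>!p. awalk r p v"
    and inner_children: "\<And>v. \<lbrakk>v \<in> verts T; out_arcs T v \<noteq> {}\<rbrakk> \<Longrightarrow> 2 \<le> card (out_arcs T v)"
    and stage_equiv: "equiv (verts T) S"
    and labels_inj: "\<And>v. v \<in> verts T \<Longrightarrow> inj_on \<theta> (out_arcs T v)"
    and same_stage: "\<And>u v. \<lbrakk>u \<in> verts T; v \<in> verts T; out_arcs T u \<noteq> {}; out_arcs T v \<noteq> {};
        (u, v) \<in> S\<rbrakk> \<Longrightarrow> \<theta> ` out_arcs T u = \<theta> ` out_arcs T v"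
    and different_stage: "\<And>u v. \<lbrakk>u \<in> verts T; v \<in> verts T; out_arcs T u \<noteq> {}; out_arcs T v \<noteq> {};
        (u, v) \<notin> S\<rbrakk> \<Longrightarrow> \<theta> ` out_arcs T u \<inter> \<theta> ` out_arcs T v = {}"
    and leaves_same_stage: "\<And>u v. \<lbrakk>u \<in> verts T; v \<in> verts T; out_arcs T u = {}; out_arcs T v = {}\<rbrakk>
        \<Longrightarrow> (u, v) \<in> S"

definition paths_to_leaves :: "('v, 'e) pre_digraph \<Rightarrow> 'v \<Rightarrow> 'e list set" where
  "paths_to_leaves T v = {p. \<exists>l\<in>verts T. out_arcs T l = {} \<and> pre_digraph.awalk T v p l}"

definition pvar :: "'x \<Rightarrow> ('x \<Rightarrow>\<^sub>0 nat) \<Rightarrow>\<^sub>0 real" where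
  "pvar x = Poly_Mapping.single (Poly_Mapping.single x 1) 1"

definition t_poly :: "('v, 'e) pre_digraph \<Rightarrow> ('e \<Rightarrow> 'l) \<Rightarrow> 'v \<Rightarrow> ('l \<Rightarrow>\<^sub>0 nat) \<Rightarrow>\<^sub>0 real" where
  "t_poly T \<theta> v = (\<Sum>p\<in>paths_to_leaves T v. \<Prod>e\<in>set p. pvar (\<theta> e))"

text \<open>
  The children \<open>u\<^sub>i\<close>, \<open>v\<^sub>i\<close> are the heads of the edges \<open>e\<^sub>i\<close>, \<open>f\<^sub>i\<close> out of \<open>u\<close>, \<open>v\<close> that carry
  the same label.
\<close>

definition balanced ::
    "('v, 'e) pre_digraph \<Rightarrow> ('v \<times> 'v) set \<Rightarrow> ('e \<Rightarrow> 'l) \<Rightarrow> bool" where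
  "balanced T S \<theta> \<longleftrightarrow>
     (\<forall>(u, v)\<in>S. \<forall>e\<^sub>i\<in>out_arcs T u. \<forall>e\<^sub>j\<in>out_arcs T u. \<forall>f\<^sub>i\<in>out_arcs T v. \<forall>f\<^sub>j\<in>out_arcs T v.
        \<theta> e\<^sub>i = \<theta> f\<^sub>i \<longrightarrow> \<theta> e\<^sub>j = \<theta> f\<^sub>j \<longrightarrow>
        t_poly T \<theta> (head T e\<^sub>i) * t_poly T \<theta> (head T f\<^sub>j) =
        t_poly T \<theta> (head T e\<^sub>j) * t_poly T \<theta> (head T f\<^sub>i))"

datatype 'l tree_var = Theta 'l | Z

definition tree_depth :: "('v, 'e) pre_digraph \<Rightarrow> 'v \<Rightarrow> nat" where
  "tree_depth T r = Max ((\<lambda>p. card (set p)) ` paths_to_leaves T r)"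

definition path_monomial ::
    "('v, 'e) pre_digraph \<Rightarrow> 'v \<Rightarrow> ('e \<Rightarrow> 'l) \<Rightarrow> 'e list \<Rightarrow> ('l tree_var \<Rightarrow>\<^sub>0 nat) \<Rightarrow>\<^sub>0 real" where
  "path_monomial T r \<theta> p =
     pvar Z ^ (tree_depth T r - card (set p)) * (\<Prod>e\<in>set p. pvar (Theta (\<theta> e)))"

definition tree_algebra ::
    "('v, 'e) pre_digraph \<Rightarrow> 'v \<Rightarrow> ('e \<Rightarrow> 'l) \<Rightarrow> (('l tree_var \<Rightarrow>\<^sub>0 nat) \<Rightarrow>\<^sub>0 real) set" where
  "tree_algebra T r \<theta> = algebra_generated (path_monomial T r \<theta> ` paths_to_leaves T r)"

text \<open>
  The grading that puts the path monomials, which have total degree \<open>d\<close>, in degree one.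
  For the one-vertex tree \<open>d = 0\<close> and the algebra is \<open>\<real>\<close>; the last conjunct then puts it in
  degree 0.
\<close>

definition tree_grading ::
    "('v, 'e) pre_digraph \<Rightarrow> 'v \<Rightarrow> ('e \<Rightarrow> 'l) \<Rightarrow> nat \<Rightarrow> (('l tree_var \<Rightarrow>\<^sub>0 nat) \<Rightarrow>\<^sub>0 real) set" where
  "tree_grading T r \<theta> m =
     {f \<in> tree_algebra T r \<theta>. \<forall>\<alpha>\<in>Poly_Mapping.keys f.
        (\<Sum>x\<in>Poly_Mapping.keys \<alpha>. Poly_Mapping.lookup \<alpha> x) = m * tree_depth T r \<and>
        (tree_depth T r = 0 \<longrightarrow> m = 0)}"

end

theory Submission
  imports Defs "HOL-Library.Multiset" "HOL-Library.List_Lexorder"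
begin

text \<open>
  Encode root-to-leaf paths by their label words. Order the labels and call a tuple of paths
  ordered if, in its concatenation, labels of the same stage occur in increasing order. An ordered
  tuple is determined by its length and its multiset of labels, since at every vertex it must take
  the smallest label of the stage that is still available. Conversely, a lexicographically minimal
  tuple with a given product of monomials is ordered: balancedness permits the swap of two
  labels of the same stage, in different paths or in one path, that are in the wrong order.
  Being ordered is a condition on pairs of paths, so the toric ideal has a quadratic Groebner
  basis.

  For such an algebra a linear resolution of the residue field is built by induction. The free
  modules have bases of chains, words \<open>w\<close> each of whose letters lies in the state of the preceding
  ones. If \<open>m\<close> is a normal monomial without letters from the state of \<open>w y\<close>, then the differential
  takes \<open>m e\<^bsub>w y\<^esub>\<close> to \<open>(m y) e\<^sub>w\<close> plus smaller terms. These leading terms are exactly the monomials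
  outside the span of the \<open>m e\<^sub>w\<close> such that \<open>m\<close> has no letter from the state of \<open>w\<close>, which gives
  exactness.
\<close>

section \<open>Monomial algebras with quadratic normal forms\<close>

text \<open>The shape of \<open>state\<close> is dictated by a matching of real basis vectors: strip
  from a normal monomial the smallest letter \<open>y\<close> that lies in the state of
  \<open>w\<close>, and append it to the word. What is left has no smaller letter of the old state
  and, the monomial being normal, no letter incompatible with \<open>y\<close>; these exclusions are
  the two halves of \<open>state (y # w)\<close>. The stripped factor has degree one, which is where
  linearity comes from. The differential is recursive, and its correction terms have to stay below
  the new leading term, or triangularity would be lost at the next step. Plain exactness gives no
  such control, so exactness is proved together with a bound on the keys of the preimage. On the
  tree side the obstacle is a pair of wrongly ordered labels in one path: balancedness compares
  products over two vertices, hence two paths, and a single coefficient of it says nothing about one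
  path. The power of \<open>Z\<close> gives all path monomials the degree \<open>d\<close>, so that
  for \<open>d > 0\<close> a product reveals its number of factors.\<close>

definition mset_less :: "'x::linorder multiset \<Rightarrow> 'x multiset \<Rightarrow> bool" where
  "mset_less \<alpha> \<beta> \<longleftrightarrow>
     size \<alpha> = size \<beta> \<and> sorted_list_of_multiset \<alpha> < sorted_list_of_multiset \<beta>"

lemma mset_less_trans: "mset_less \<alpha> \<beta> \<Longrightarrow> mset_less \<beta> \<gamma> \<Longrightarrow> mset_less \<alpha> \<gamma>"
  by (auto simp: mset_less_def)

lemma mset_less_irrefl [simp]: "\<not> mset_less \<alpha> \<alpha>"
  by (auto simp: mset_less_def)

text \<open>This is what makes the lexicographic comparison of sorted lists a monomial order: it
  survives multiplication of both sides by a letter.\<close>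

lemma insort_less_insort:
  fixes xs ys :: "'x::linorder list"
  assumes "length xs = length ys" "sorted xs" "sorted ys" "xs < ys"
  shows "insort a xs < insort a ys"
  using assms by (induction xs ys rule: list_induct2) auto

lemma mset_less_add_mset: "mset_less \<alpha> \<beta> \<Longrightarrow> mset_less (add_mset x \<alpha>) (add_mset x \<beta>)"
proof -
  have "length (sorted_list_of_multiset \<gamma>) = size \<gamma>" for \<gamma> :: "'a multiset"
    by (metis mset_sorted_list_of_multiset size_mset)
  then show "mset_less \<alpha> \<beta> \<Longrightarrow> ?thesis"
    by (auto simp: mset_less_def intro!: insort_less_insort)
qed

lemma mset_less_add: "mset_less \<alpha> \<beta> \<Longrightarrow> mset_less (\<gamma> + \<alpha>) (\<gamma> + \<beta>)"
  by (induction \<gamma>) (auto intro: mset_less_add_mset)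

text \<open>Keys are comparable only if their multisets have equal size. Over a finite alphabet this
  leaves finitely many keys below a given one, and it keeps the differential homogeneous.\<close>

definition key_less :: "'x::linorder multiset \<times> 'x list \<Rightarrow> 'x multiset \<times> 'x list \<Rightarrow> bool" where
  "key_less p q \<longleftrightarrow>
     mset_less (fst p) (fst q) \<or> fst p = fst q \<and> length (snd p) = length (snd q) \<and> rev (snd p) < rev (snd q)"

lemma key_less_trans: "key_less p q \<Longrightarrow> key_less q s \<Longrightarrow> key_less p s"
  by (auto simp: key_less_def dest: mset_less_trans)

lemma key_less_irrefl [simp]: "\<not> key_less p p"
  by (auto simp: key_less_def)

lemma key_less_add:
  "key_less (\<alpha>, v) (\<beta>, w) \<Longrightarrow> key_less (\<gamma> + \<alpha>, v) (\<gamma> + \<beta>, w)"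
  by (auto simp: key_less_def dest: mset_less_add)

lemma append_less_append:
  fixes us vs :: "'x::linorder list"
  assumes "length us = length vs"
  shows "us @ [x] < vs @ [y] \<longleftrightarrow> us < vs \<or> us = vs \<and> x < y"
  using assms by (induction us vs rule: list_induct2) auto

lemma pair_subset_add_mset:
  "{#x, y#} \<subseteq># add_mset z M \<longleftrightarrow> {#x, y#} \<subseteq># M \<or> x = z \<and> y \<in># M \<or> y = z \<and> x \<in># M"
proof (cases "x = z \<or> y = z")
  case True
  then show ?thesis
    by (auto simp: add_mset_commute[of x] dest: mset_subset_eqD[of "{#_, _#}"])
next
  case False
  have "{#x, y#} \<subseteq># M" if "{#x, y#} \<subseteq># add_mset z M"
    unfolding subseteq_mset_def
  proof
    fix c show "count {#x, y#} c \<le> count M c"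
      using mset_subset_eq_count[OF that, of c] False by (cases "c = z") auto
  qed
  then show ?thesis
    using False by (auto intro: subset_mset.order_trans[of _ M])
qed

text \<open>For \<open>x = y\<close> the condition concerns only letters of multiplicity at least
  two. A letter may thus be incompatible with itself and still occur once; this does happen for path
  words.\<close>

definition normal :: "'x set \<Rightarrow> ('x \<Rightarrow> 'x \<Rightarrow> bool) \<Rightarrow> 'x multiset \<Rightarrow> bool" where
  "normal X good \<alpha> \<longleftrightarrow> set_mset \<alpha> \<subseteq> X \<and> (\<forall>x y. {#x, y#} \<subseteq># \<alpha> \<longrightarrow> good x y)"

section \<open>Elements of free modules in real coordinates, indexed by pairs of a monomial and a
  word\<close>

definition terms :: "('x list \<Rightarrow> ('k \<Rightarrow>\<^sub>0 real)) \<Rightarrow> ('k \<times> 'x list) set" where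
  "terms x = {p. Poly_Mapping.lookup (x (snd p)) (fst p) \<noteq> 0}"

definition elts :: "('k \<times> 'x list) set \<Rightarrow> ('x list \<Rightarrow> ('k \<Rightarrow>\<^sub>0 real)) set" where
  "elts P = {x. terms x \<subseteq> P}"

definition unit_vec :: "'k \<times> 'x list \<Rightarrow> 'x list \<Rightarrow> ('k \<Rightarrow>\<^sub>0 real)" where
  "unit_vec p = (\<lambda>v. if v = snd p then Poly_Mapping.single (fst p) 1 else 0)"

lemma lookup_unit_vec: "Poly_Mapping.lookup (unit_vec p v) k = (if p = (k, v) then 1 else 0)"
  by (cases p) (auto simp: unit_vec_def lookup_single when_def)

lemma elts_iff: "x \<in> elts P \<longleftrightarrow> (\<forall>h w. Poly_Mapping.lookup (x w) h \<noteq> 0 \<longrightarrow> (h, w) \<in> P)"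
  by (auto simp: elts_def terms_def)

lemma unit_vec_elts [simp]: "unit_vec p \<in> elts P \<longleftrightarrow> p \<in> P"
  by (cases p) (auto simp: elts_iff lookup_unit_vec)

lemma zero_elts [simp]: "(\<lambda>v. 0) \<in> elts P"
  by (simp add: elts_iff)

lemma elts_add: "x \<in> elts P \<Longrightarrow> y \<in> elts P \<Longrightarrow> (\<lambda>v. x v + y v) \<in> elts P"
  unfolding elts_iff lookup_add by (metis add_0)

lemma elts_diff: "x \<in> elts P \<Longrightarrow> y \<in> elts P \<Longrightarrow> (\<lambda>v. x v - y v) \<in> elts P"
  unfolding elts_iff lookup_minus by (metis diff_zero)

lemma elts_scaleR: "x \<in> elts P \<Longrightarrow> (\<lambda>v. c *\<^sub>R x v) \<in> elts P"
  by (auto simp: elts_iff lookup_scaleR_poly_mapping)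

lemma elts_mono: "x \<in> elts P \<Longrightarrow> P \<subseteq> Q \<Longrightarrow> x \<in> elts Q"
  by (auto simp: elts_iff)

lemma elts_single_mult:
  fixes x :: "'x list \<Rightarrow> ('k::cancel_comm_monoid_add \<Rightarrow>\<^sub>0 real)"
  assumes "x \<in> elts P"
  shows "(\<lambda>v. Poly_Mapping.single h 1 * x v) \<in> elts ((\<lambda>(k, v). (h + k, v)) ` P)"
  unfolding elts_iff
proof (intro allI impI)
  fix l w assume "Poly_Mapping.lookup (Poly_Mapping.single h 1 * x w) l \<noteq> 0"
  then have "l \<in> Poly_Mapping.keys (Poly_Mapping.single h 1 * x w)"
    by (simp add: in_keys_iff)
  then obtain k where k: "l = h + k" "k \<in> Poly_Mapping.keys (x w)"
    using keys_mult[of "Poly_Mapping.single h 1" "x w"] by auto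
  then have "(k, w) \<in> P"
    using assms by (auto simp: elts_iff in_keys_iff)
  then show "(l, w) \<in> (\<lambda>(k, v). (h + k, v)) ` P"
    using k by force
qed

lemma subspace_keys: "subspace {f :: 'k \<Rightarrow>\<^sub>0 real. Poly_Mapping.keys f \<subseteq> K}"
  unfolding subspace_def
  by (auto simp: in_keys_iff lookup_add lookup_scaleR_poly_mapping subset_iff) (metis add_0)

lemma sum_single: "f = (\<Sum>k\<in>Poly_Mapping.keys f. Poly_Mapping.lookup f k *\<^sub>R Poly_Mapping.single k (1::real))"
proof (rule poly_mapping_eqI)
  fix l
  have "Poly_Mapping.lookup (\<Sum>k\<in>Poly_Mapping.keys f. Poly_Mapping.lookup f k *\<^sub>R Poly_Mapping.single k (1::real)) l
    = (\<Sum>k\<in>Poly_Mapping.keys f. if k = l then Poly_Mapping.lookup f k else 0)"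
    unfolding lookup_sum by (intro sum.cong) (auto simp: lookup_scaleR_poly_mapping lookup_single)
  also have "\<dots> = Poly_Mapping.lookup f l"
    by (simp add: in_keys_iff)
  finally show "Poly_Mapping.lookup f l = Poly_Mapping.lookup
      (\<Sum>k\<in>Poly_Mapping.keys f. Poly_Mapping.lookup f k *\<^sub>R Poly_Mapping.single k (1::real)) l"
    by simp
qed

lemma span_single_eq:
  "span ((\<lambda>k. Poly_Mapping.single k (1::real)) ` K) = {f. Poly_Mapping.keys f \<subseteq> K}"
proof (rule subset_antisym)
  show "span ((\<lambda>k. Poly_Mapping.single k (1::real)) ` K) \<subseteq> {f. Poly_Mapping.keys f \<subseteq> K}"
    by (rule span_minimal[OF _ subspace_keys]) auto
  show "{f. Poly_Mapping.keys f \<subseteq> K} \<subseteq> span ((\<lambda>k. Poly_Mapping.single k (1::real)) ` K)"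
  proof
    fix f :: "'a \<Rightarrow>\<^sub>0 real" assume f: "f \<in> {f. Poly_Mapping.keys f \<subseteq> K}"
    then have "(\<Sum>k\<in>Poly_Mapping.keys f. Poly_Mapping.lookup f k *\<^sub>R Poly_Mapping.single k (1::real))
        \<in> span ((\<lambda>k. Poly_Mapping.single k (1::real)) ` K)"
      by (intro span_sum span_scale span_base) auto
    then show "f \<in> span ((\<lambda>k. Poly_Mapping.single k (1::real)) ` K)"
      by (simp only: sum_single[of f, symmetric])
  qed
qed

lemma of_real_eq_single: "(of_real c :: 'k::comm_monoid_add \<Rightarrow>\<^sub>0 real) = Poly_Mapping.single 0 c"
  by (intro poly_mapping_eqI) (simp add: of_real_def lookup_scaleR_poly_mapping lookup_one lookup_single when_def)

text \<open>The last two assumptions describe the standard monomials of a quadratic Groebner basis: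
  \<open>normal\<close> tests pairs only, normal multisets represent products uniquely, and
  rewriting to the representative never goes up. As \<open>mset_less\<close> includes equality of
  sizes, the number of letters is an invariant of the product and yields the grading.\<close>

locale quadratic_monoid =
  fixes X :: "'x::linorder set" and g :: "'x \<Rightarrow> 'k::cancel_comm_monoid_add"
    and good :: "'x \<Rightarrow> 'x \<Rightarrow> bool"
  assumes finite_letters: "finite X"
    and good_sym: "good x y \<Longrightarrow> good y x"
    and normal_unique: "\<lbrakk>normal X good \<alpha>; normal X good \<beta>;
        (\<Sum>x\<in>#\<alpha>. g x) = (\<Sum>x\<in>#\<beta>. g x)\<rbrakk> \<Longrightarrow> \<alpha> = \<beta>"
    and normal_ex: "set_mset \<alpha> \<subseteq> X \<Longrightarrow> \<exists>\<beta>. normal X good \<beta> \<and>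
        (\<Sum>x\<in>#\<beta>. g x) = (\<Sum>x\<in>#\<alpha>. g x) \<and> (\<beta> = \<alpha> \<or> mset_less \<beta> \<alpha>)"
begin

section \<open>The monoid of monomials and its normal forms\<close>

definition monom :: "'x multiset \<Rightarrow> 'k" where
  "monom \<alpha> = (\<Sum>x\<in>#\<alpha>. g x)"

definition H :: "'k set" where
  "H = monom ` {\<alpha>. set_mset \<alpha> \<subseteq> X}"

definition nf :: "'k \<Rightarrow> 'x multiset" where
  "nf h = (THE \<alpha>. normal X good \<alpha> \<and> monom \<alpha> = h)"

lemma monom_add: "monom (\<alpha> + \<beta>) = monom \<alpha> + monom \<beta>"
  by (simp add: monom_def)

lemma monom_single [simp]: "monom {#x#} = g x" and monom_empty [simp]: "monom {#} = 0"
  by (simp_all add: monom_def)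

lemma nf_monom:
  assumes "set_mset \<alpha> \<subseteq> X"
  shows "normal X good (nf (monom \<alpha>))" "monom (nf (monom \<alpha>)) = monom \<alpha>"
    "nf (monom \<alpha>) = \<alpha> \<or> mset_less (nf (monom \<alpha>)) \<alpha>"
proof -
  obtain \<beta> where \<beta>: "normal X good \<beta>" "monom \<beta> = monom \<alpha>" "\<beta> = \<alpha> \<or> mset_less \<beta> \<alpha>"
    using normal_ex[OF assms] unfolding monom_def by blast
  have "nf (monom \<alpha>) = \<beta>"
    unfolding nf_def
    by (rule the_equality) (use \<beta> normal_unique in \<open>auto simp: monom_def\<close>)
  then show "normal X good (nf (monom \<alpha>))" "monom (nf (monom \<alpha>)) = monom \<alpha>"
    "nf (monom \<alpha>) = \<alpha> \<or> mset_less (nf (monom \<alpha>)) \<alpha>"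
    using \<beta> by auto
qed

lemma nf_monom_normal: "normal X good \<alpha> \<Longrightarrow> nf (monom \<alpha>) = \<alpha>"
  using nf_monom[of \<alpha>] normal_unique by (metis monom_def normal_def)

lemma normal_nf: "h \<in> H \<Longrightarrow> normal X good (nf h)"
  and monom_nf: "h \<in> H \<Longrightarrow> monom (nf h) = h"
  by (auto simp: H_def nf_monom)

lemma nf_letters: "h \<in> H \<Longrightarrow> set_mset (nf h) \<subseteq> X"
  using normal_nf by (auto simp: normal_def)

lemma monomI: "set_mset \<alpha> \<subseteq> X \<Longrightarrow> monom \<alpha> \<in> H"
  by (auto simp: H_def)

lemma H_add: "h \<in> H \<Longrightarrow> k \<in> H \<Longrightarrow> h + k \<in> H"
  using monomI[of "nf h + nf k"] nf_letters[of h] nf_letters[of k]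
  by (simp add: monom_add monom_nf)

lemma nf_add:
  assumes "h \<in> H" "k \<in> H"
  shows "nf (h + k) = nf h + nf k \<or> mset_less (nf (h + k)) (nf h + nf k)"
  using nf_monom(3)[of "nf h + nf k"] nf_letters[OF assms(1)] nf_letters[OF assms(2)] assms
  by (simp add: monom_add monom_nf)

lemma size_nf_add: "h \<in> H \<Longrightarrow> k \<in> H \<Longrightarrow> size (nf (h + k)) = size (nf h) + size (nf k)"
  using nf_add by (fastforce simp: mset_less_def)

lemma g_in_H [simp]: "x \<in> X \<Longrightarrow> g x \<in> H"
  using monomI[of "{#x#}"] by simp

lemma zero_in_H [simp]: "0 \<in> H"
  using monomI[of "{#}"] by simp

lemma nf_g [simp]: "x \<in> X \<Longrightarrow> nf (g x) = {#x#}"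
  using nf_monom_normal[of "{#x#}"] by (auto simp: normal_def dest: size_mset_mono)

lemma nf_zero [simp]: "nf 0 = {#}"
  using nf_monom_normal[of "{#}"] by (auto simp: normal_def)

lemma nf_eq_empty: "h \<in> H \<Longrightarrow> nf h = {#} \<Longrightarrow> h = 0"
  using monom_nf by force

text \<open>
  Words are stored with their last letter first, so that \<open>y # w\<close> extends \<open>w\<close> by \<open>y\<close>.
\<close>

primrec state :: "'x list \<Rightarrow> 'x set" where
  "state [] = X"
| "state (y # w) = {z \<in> state w. z < y} \<union> {z \<in> X. \<not> good z y}"

primrec chain :: "'x list \<Rightarrow> bool" where
  "chain [] \<longleftrightarrow> True"
| "chain (y # w) \<longleftrightarrow> y \<in> state w \<and> chain w"

definition chains :: "nat \<Rightarrow> 'x list set" where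
  "chains i = {w. chain w \<and> length w = i}"

lemma state_letters: "state w \<subseteq> X"
  by (induction w) auto

lemma chain_letters: "chain w \<Longrightarrow> set w \<subseteq> X"
  using state_letters by (induction w) auto

lemma finite_chains: "finite (chains i)"
  by (rule finite_subset[OF _ finite_lists_length_eq[OF finite_letters, of i]])
    (auto simp: chains_def dest: chain_letters)

lemma chains_0 [simp]: "chains 0 = {[]}"
  by (auto simp: chains_def)

lemma chains_SucE:
  assumes "w \<in> chains (Suc i)"
  obtains y v where "w = y # v" "v \<in> chains i" "y \<in> state v" "y \<in> X"
  using assms state_letters by (cases w) (auto simp: chains_def)

lemma Cons_in_chains: "y # w \<in> chains (Suc i) \<longleftrightarrow> y \<in> state w \<and> w \<in> chains i"
  by (auto simp: chains_def)

definition basis :: "nat \<Rightarrow> ('k \<times> 'x list) set" where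
  "basis i = H \<times> chains i"

text \<open>For a chain \<open>y # w\<close>, stability of \<open>(h, y # w)\<close> means that
  multiplication by \<open>y\<close> stays normal and that \<open>y\<close> is the smallest letter
  of the product in the state of \<open>w\<close>. Hence the unstable pair
  \<open>(h + g y, w)\<close>, its partner, determines it.\<close>

definition stable :: "'k \<times> 'x list \<Rightarrow> bool" where
  "stable p \<longleftrightarrow> set_mset (nf (fst p)) \<inter> state (snd p) = {}"

text \<open>
  Leading terms are taken with respect to \<open>key_less\<close> on keys: first the multiset of all letters,
  which can only drop when a product is rewritten to normal form, then the word, read from its
  first letter.
\<close>

definition key :: "'k \<times> 'x list \<Rightarrow> 'x multiset \<times> 'x list" where
  "key p = (nf (fst p) + mset (snd p), snd p)"

lemma key_inj: "p \<in> basis i \<Longrightarrow> q \<in> basis j \<Longrightarrow> key p = key q \<Longrightarrow> p = q"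
  using monom_nf by (auto simp: key_def basis_def) metis

text \<open>Multisets of smaller keys have the size of the given one and letters in the finite set
  \<open>X\<close>. This makes induction on keys possible.\<close>

lemma finite_key_less: "finite {q \<in> basis i. key_less (key q) (key p)}"
proof -
  let ?N = "size (nf (fst p) + mset (snd p))"
  have "finite {xs. set xs \<subseteq> X \<and> length xs = ?N}"
    by (rule finite_lists_length_eq[OF finite_letters])
  then have "finite (mset ` {xs. set xs \<subseteq> X \<and> length xs = ?N} \<times> chains i)"
    using finite_chains by blast
  moreover have "key ` {q \<in> basis i. key_less (key q) (key p)} \<subseteq>
      mset ` {xs. set xs \<subseteq> X \<and> length xs = ?N} \<times> chains i"
  proof (rule image_subsetI)
    fix q assume q: "q \<in> {q \<in> basis i. key_less (key q) (key p)}"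
    obtain h w where [simp]: "q = (h, w)" by fastforce
    have hw: "(h, w) \<in> basis i" and less: "key_less (key (h, w)) (key p)"
      using q by auto
    have "size (nf h + mset w) = ?N"
      using less by (auto simp: key_less_def key_def mset_less_def dest: arg_cong[of _ _ size])
    moreover obtain xs where xs: "mset xs = nf h + mset w"
      using ex_mset by blast
    moreover have "set_mset (nf h + mset w) \<subseteq> X"
      using hw nf_letters chain_letters by (fastforce simp: basis_def chains_def)
    then have "set xs \<subseteq> X"
      by (metis xs set_mset_mset)
    ultimately show "key q \<in> mset ` {xs. set xs \<subseteq> X \<and> length xs = ?N} \<times> chains i"
      using hw by (auto simp: key_def basis_def intro!: image_eqI[of _ _ xs] simp flip: size_mset)
  qed
  ultimately have "finite (key ` {q \<in> basis i. key_less (key q) (key p)})"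
    by (rule rev_finite_subset)
  moreover have "inj_on key {q \<in> basis i. key_less (key q) (key p)}"
    by (rule inj_onI) (blast intro: key_inj)
  ultimately show ?thesis
    by (rule finite_imageD)
qed

lemma basis_induct [consumes 1, case_names less]:
  assumes "p \<in> basis i"
    and step: "\<And>p. p \<in> basis i \<Longrightarrow> (\<And>q. q \<in> basis i \<Longrightarrow> key_less (key q) (key p) \<Longrightarrow> P q) \<Longrightarrow> P p"
  shows "P p"
  using assms(1)
proof (induction "card {q \<in> basis i. key_less (key q) (key p)}" arbitrary: p rule: less_induct)
  case less
  show ?case
  proof (rule step[OF less.prems])
    fix q assume q: "q \<in> basis i" "key_less (key q) (key p)"
    have "{s \<in> basis i. key_less (key s) (key q)} \<subset> {s \<in> basis i. key_less (key s) (key p)}"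
      using q key_less_trans[of _ "key q" "key p"] key_less_irrefl[of "key q"] by blast
    then show "P q"
      using less.hyps q psubset_card_mono[OF finite_key_less] by blast
  qed
qed

text \<open>Stability excludes letters incompatible with \<open>y\<close>, so the product needs no
  rewriting; \<open>y\<close> itself, a letter of the state of \<open>w\<close>, witnesses
  instability.\<close>

lemma nf_add_letter:
  assumes "h \<in> H" "y # w \<in> chains (Suc i)" "stable (h, y # w)"
  shows "nf (h + g y) = add_mset y (nf h)" "\<not> stable (h + g y, w)"
proof -
  have y: "y \<in> state w" "y \<in> X"
    using assms(2) state_letters by (auto simp: Cons_in_chains)
  have good: "good z y" if "z \<in># nf h" for z
    using that assms(3) nf_letters[OF assms(1)] by (auto simp: stable_def)
  have "normal X good (add_mset y (nf h))"
    unfolding normal_def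
  proof (intro conjI allI impI)
    show "set_mset (add_mset y (nf h)) \<subseteq> X"
      using y nf_letters[OF assms(1)] by auto
    fix a b assume ab: "{#a, b#} \<subseteq># add_mset y (nf h)"
    then show "good a b"
      using good good_sym normal_nf[OF assms(1)]
      by (auto simp: pair_subset_add_mset normal_def)
  qed
  then show "nf (h + g y) = add_mset y (nf h)"
    using nf_monom_normal[of "add_mset y (nf h)"] monom_nf[OF assms(1)]
    by (metis add.commute add_mset_add_single monom_add monom_single)
  then show "\<not> stable (h + g y, w)"
    using y by (auto simp: stable_def)
qed

text \<open>The inverse of the matching: the smallest letter of \<open>nf k\<close> in the state of
  \<open>w\<close> moves to the word. Its minimality and the normality of \<open>nf k\<close> give
  the two halves of stability.\<close>

lemma unstable_cases:
  assumes "(k, w) \<in> basis i" "\<not> stable (k, w)"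
  obtains h y where "h \<in> H" "y # w \<in> chains (Suc i)" "stable (h, y # w)" "k = h + g y"
    "nf k = add_mset y (nf h)" "\<And>z. z \<in> state w \<Longrightarrow> z \<in># nf k \<Longrightarrow> y \<le> z"
proof -
  define y where "y = Min (set_mset (nf k) \<inter> state w)"
  have ne: "set_mset (nf k) \<inter> state w \<noteq> {}"
    using assms(2) by (auto simp: stable_def)
  have y: "y \<in># nf k" "y \<in> state w" "\<And>z. z \<in> state w \<Longrightarrow> z \<in># nf k \<Longrightarrow> y \<le> z"
    using Min_in[OF _ ne] Min_le[of "set_mset (nf k) \<inter> state w"] unfolding y_def by auto
  obtain \<mu> where \<mu>: "nf k = add_mset y \<mu>"
    using y(1) by (meson multi_member_split)
  have k: "k \<in> H"
    using assms(1) by (simp add: basis_def)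
  have n: "normal X good (add_mset y \<mu>)"
    using normal_nf[OF k] by (simp add: \<mu>)
  have "normal X good \<mu>"
    using n unfolding normal_def
    by (auto intro: subset_mset.order_trans[OF _ multi_psub_of_add_self[THEN subset_mset.less_imp_le]])
  then have nf: "nf (monom \<mu>) = \<mu>"
    by (rule nf_monom_normal)
  have h: "monom \<mu> \<in> H"
    using n by (auto simp: normal_def intro: monomI)
  have "k = monom \<mu> + g y"
    using monom_nf[OF k] by (metis \<mu> add_mset_add_single monom_add monom_single)
  moreover have "y # w \<in> chains (Suc i)"
    using assms(1) y by (simp add: Cons_in_chains basis_def)
  moreover have "stable (monom \<mu>, y # w)"
  proof -
    have "good z y" if "z \<in># \<mu>" for z
      using n that unfolding normal_def by (metis add_mset_commute mset_subset_eq_add_mset_cancel single_subset_iff)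
    moreover have "\<not> z < y" if "z \<in># \<mu>" "z \<in> state w" for z
      using y(3)[of z] that \<mu> by auto
    ultimately show ?thesis
      by (auto simp: stable_def nf)
  qed
  ultimately show ?thesis
    using that[of "monom \<mu>" y] h \<mu> nf y by auto
qed

section \<open>Finite expansions in the real basis\<close>

lemma finite_terms:
  assumes "x \<in> elts (basis i)"
  shows "finite (terms x)"
proof (rule finite_subset)
  show "terms x \<subseteq> (\<Union>w\<in>chains i. Poly_Mapping.keys (x w) \<times> {w})"
  proof
    fix p assume p: "p \<in> terms x"
    moreover have "p \<in> basis i"
      using p assms by (auto simp: elts_def)
    ultimately show "p \<in> (\<Union>w\<in>chains i. Poly_Mapping.keys (x w) \<times> {w})"
      by (cases p) (auto simp: terms_def basis_def in_keys_iff)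
  qed
  show "finite (\<Union>w\<in>chains i. Poly_Mapping.keys (x w) \<times> {w})"
    using finite_chains by auto
qed

lemma sum_terms:
  assumes "x \<in> elts (basis i)"
  shows "x v = (\<Sum>p\<in>terms x. Poly_Mapping.lookup (x (snd p)) (fst p) *\<^sub>R unit_vec p v)"
proof (rule poly_mapping_eqI)
  fix k
  have "Poly_Mapping.lookup (\<Sum>p\<in>terms x. Poly_Mapping.lookup (x (snd p)) (fst p) *\<^sub>R unit_vec p v) k =
     (\<Sum>p\<in>terms x. if p = (k, v) then Poly_Mapping.lookup (x v) k else 0)"
    unfolding lookup_sum lookup_scaleR_poly_mapping lookup_unit_vec by (intro sum.cong) auto
  also have "\<dots> = Poly_Mapping.lookup (x v) k"
    using finite_terms[OF assms] by (auto simp: terms_def)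
  finally show "Poly_Mapping.lookup (x v) k =
      Poly_Mapping.lookup (\<Sum>p\<in>terms x. Poly_Mapping.lookup (x (snd p)) (fst p) *\<^sub>R unit_vec p v) k"
    by simp
qed

lemma elts_induct [consumes 2, case_names zero add scale]:
  assumes "x \<in> elts P" "P \<subseteq> basis i"
    and "Q (\<lambda>v. 0)" and add: "\<And>x y. Q x \<Longrightarrow> Q y \<Longrightarrow> Q (\<lambda>v. x v + y v)"
    and scale: "\<And>c p. p \<in> P \<Longrightarrow> Q (\<lambda>v. c *\<^sub>R unit_vec p v)"
  shows "Q x"
proof -
  have sums: "Q (\<lambda>v. \<Sum>p\<in>F. c p *\<^sub>R unit_vec p v)" if "finite F" "F \<subseteq> P" for F c
    using that by (induction F) (auto intro: assms)
  have x: "x \<in> elts (basis i)"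
    using assms(1,2) by (rule elts_mono)
  have "terms x \<subseteq> P"
    using assms(1) by (simp add: elts_def)
  then have "Q (\<lambda>v. \<Sum>p\<in>terms x. Poly_Mapping.lookup (x (snd p)) (fst p) *\<^sub>R unit_vec p v)"
    by (rule sums[OF finite_terms[OF x]])
  then show ?thesis
    by (simp only: sum_terms[OF x, symmetric])
qed

section \<open>Linear maps given on chains, and their leading terms\<close>

definition lin :: "nat \<Rightarrow> ('x list \<Rightarrow> 'x list \<Rightarrow> ('k \<Rightarrow>\<^sub>0 real)) \<Rightarrow> ('x list \<Rightarrow> ('k \<Rightarrow>\<^sub>0 real))
    \<Rightarrow> 'x list \<Rightarrow> ('k \<Rightarrow>\<^sub>0 real)" where
  "lin i d x = (\<lambda>v. \<Sum>w\<in>chains (Suc i). x w * d w v)"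

lemma lin_zero [simp]: "lin i d (\<lambda>v. 0) = (\<lambda>v. 0)"
  by (simp add: lin_def)

lemma lin_add: "lin i d (\<lambda>v. x v + y v) v = lin i d x v + lin i d y v"
  by (simp add: lin_def distrib_right sum.distrib)

lemma lin_diff: "lin i d (\<lambda>v. x v - y v) v = lin i d x v - lin i d y v"
  by (simp add: lin_def left_diff_distrib sum_subtractf)

lemma lin_mult: "lin i d (\<lambda>v. a * x v) v = a * lin i d x v"
  by (simp add: lin_def sum_distrib_left mult.assoc)

lemma lin_scaleR: "lin i d (\<lambda>v. c *\<^sub>R x v) v = c *\<^sub>R lin i d x v"
  by (simp add: lin_def scaleR_sum_right)

lemma lin_sum: "finite A \<Longrightarrow> lin i d (\<lambda>v. \<Sum>a\<in>A. f a v) v = (\<Sum>a\<in>A. lin i d (f a) v)"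
  by (induction A rule: finite_induct) (simp_all add: lin_add)

lemma lin_unit_vec:
  "w \<in> chains (Suc i) \<Longrightarrow> lin i d (unit_vec (h, w)) v = Poly_Mapping.single h 1 * d w v"
  by (simp add: lin_def unit_vec_def if_distrib[of "\<lambda>a. a * _"] finite_chains cong: if_cong)

definition triangular :: "nat \<Rightarrow> ('x list \<Rightarrow> 'x list \<Rightarrow> ('k \<Rightarrow>\<^sub>0 real)) \<Rightarrow> bool" where
  "triangular i d \<longleftrightarrow> (\<forall>y w. y # w \<in> chains (Suc i) \<longrightarrow>
     (\<lambda>v. d (y # w) v - unit_vec (g y, w) v) \<in>
       elts {q \<in> basis i. key_less (key q) (key (g y, w))})"

text \<open>Multiplication by \<open>h\<close> respects the order of keys, and rewriting the lower
  products can only lower their keys further. The leading product does not drop, because stability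
  makes \<open>add_mset y (nf h)\<close> normal.\<close>

lemma lin_stable:
  assumes "triangular i d" "(h, y # w) \<in> basis (Suc i)" "stable (h, y # w)"
  shows "(\<lambda>v. lin i d (unit_vec (h, y # w)) v - unit_vec (h + g y, w) v)
    \<in> elts {q \<in> basis i. key_less (key q) (key (h + g y, w))}"
proof -
  let ?P = "{q \<in> basis i. key_less (key q) (key (g y, w))}"
  have h: "h \<in> H" and w: "y # w \<in> chains (Suc i)"
    using assms(2) by (auto simp: basis_def)
  have y: "y \<in> X"
    using w state_letters by (auto simp: Cons_in_chains)
  have "(\<lambda>v. Poly_Mapping.single h 1 * (d (y # w) v - unit_vec (g y, w) v)) \<in> elts ((\<lambda>(k, v). (h + k, v)) ` ?P)"
    using assms(1) w by (intro elts_single_mult) (auto simp: triangular_def)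
  moreover have "(\<lambda>(k, v). (h + k, v)) ` ?P \<subseteq> {q \<in> basis i. key_less (key q) (key (h + g y, w))}"
  proof safe
    fix k v assume kv: "(k, v) \<in> basis i" and less: "key_less (key (k, v)) (key (g y, w))"
    then show "(h + k, v) \<in> basis i"
      using h H_add by (auto simp: basis_def)
    have k: "k \<in> H"
      using kv by (auto simp: basis_def)
    have "key_less (nf h + (nf k + mset v), v) (key (h + g y, w))"
      using key_less_add[of "nf k + mset v" v "add_mset y (mset w)" w "nf h"] less
        nf_add_letter(1)[OF h w assms(3)] y
      by (simp add: key_def)
    moreover have "nf (h + k) + mset v = nf h + (nf k + mset v) \<or>
        mset_less (nf (h + k) + mset v) (nf h + (nf k + mset v))"
      using nf_add[OF h k] mset_less_add[of "nf (h + k)" "nf h + nf k" "mset v"]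
      by (auto simp: ac_simps)
    ultimately show "key_less (key (h + k, v)) (key (h + g y, w))"
      using key_less_trans[of "key (h + k, v)" "(nf h + (nf k + mset v), v)" "key (h + g y, w)"]
      by (auto simp: add.assoc key_def key_less_def[of "(nf (h + k) + mset v, v)" "(nf h + (nf k + mset v), v)"])
  qed
  ultimately have "(\<lambda>v. Poly_Mapping.single h 1 * (d (y # w) v - unit_vec (g y, w) v))
      \<in> elts {q \<in> basis i. key_less (key q) (key (h + g y, w))}"
    by (rule elts_mono)
  moreover have "Poly_Mapping.single h 1 * (d (y # w) v - unit_vec (g y, w) v) =
      lin i d (unit_vec (h, y # w)) v - unit_vec (h + g y, w) v" for v
    unfolding lin_unit_vec[OF w] right_diff_distrib by (simp add: unit_vec_def mult_single)
  ultimately show ?thesis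
    by simp
qed

section \<open>Division with remainder by leading terms\<close>

definition below :: "'x multiset \<times> 'x list \<Rightarrow> ('x multiset \<times> 'x list) set" where
  "below \<kappa> = {\<mu>. \<mu> = \<kappa> \<or> key_less \<mu> \<kappa>}"

lemma below_mono: "key_less \<mu> \<kappa> \<Longrightarrow> below \<mu> \<subseteq> below \<kappa>"
  using key_less_trans[of _ \<mu> \<kappa>] by (auto simp: below_def simp del: split_paired_All)

text \<open>For a stable pair with a nonempty word this is the key of the partner, hence of the
  leading term of the image, without mention of the partner.\<close>

definition lift_key :: "'k \<times> 'x list \<Rightarrow> 'x multiset \<times> 'x list" where
  "lift_key p = (nf (fst p) + mset (snd p), tl (snd p))"

lemma lift_key_eq:
  assumes "(h, y # w) \<in> basis (Suc i)" "stable (h, y # w)"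
  shows "lift_key (h, y # w) = key (h + g y, w)"
  using nf_add_letter(1)[of h y w i] assms by (simp add: lift_key_def key_def basis_def)

definition lifts :: "nat \<Rightarrow> ('x multiset \<times> 'x list) set \<Rightarrow> ('k \<times> 'x list) set" where
  "lifts i K = {p \<in> basis (Suc i). stable p \<and> lift_key p \<in> K}"

text \<open>Division with remainder: \<open>r\<close> collects the irreducible terms, and the
  leading keys of the quotient \<open>s\<close> are confined to \<open>K\<close>. The bound later
  controls the corrections in \<open>diff\<close>.\<close>

definition reducible :: "nat \<Rightarrow> ('x list \<Rightarrow> 'x list \<Rightarrow> ('k \<Rightarrow>\<^sub>0 real)) \<Rightarrow> ('x multiset \<times> 'x list) set \<Rightarrow>
    ('x list \<Rightarrow> ('k \<Rightarrow>\<^sub>0 real)) \<Rightarrow> bool" where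
  "reducible i d K x \<longleftrightarrow> (\<exists>s\<in>elts (lifts i K). \<exists>r\<in>elts {q \<in> basis i. stable q}.
     \<forall>v. x v = lin i d s v + r v)"

lemma reducible_elts:
  assumes "x \<in> elts P" "P \<subseteq> basis i" and red: "\<And>p. p \<in> P \<Longrightarrow> reducible i d K (unit_vec p)"
  shows "reducible i d K x"
  using assms(1,2)
proof (induction rule: elts_induct)
  case zero
  show ?case
    unfolding reducible_def by (intro bexI[of _ "\<lambda>v. 0"]) auto
next
  case (add x y)
  then obtain s r s' r' where s: "s \<in> elts (lifts i K)" "s' \<in> elts (lifts i K)"
    and r: "r \<in> elts {q \<in> basis i. stable q}" "r' \<in> elts {q \<in> basis i. stable q}"
    and eq: "\<forall>v. x v = lin i d s v + r v" "\<forall>v. y v = lin i d s' v + r' v"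
    unfolding reducible_def by blast
  have "\<forall>v. x v + y v = lin i d (\<lambda>v. s v + s' v) v + (r v + r' v)"
    using eq by (simp add: lin_add)
  then show ?case
    unfolding reducible_def by (rule bexI[OF bexI[OF _ elts_add[OF r]] elts_add[OF s]])
next
  case (scale c p)
  then obtain s r where s: "s \<in> elts (lifts i K)" and r: "r \<in> elts {q \<in> basis i. stable q}"
    and eq: "\<forall>v. unit_vec p v = lin i d s v + r v"
    using red unfolding reducible_def by blast
  have "\<forall>v. c *\<^sub>R unit_vec p v = lin i d (\<lambda>v. c *\<^sub>R s v) v + c *\<^sub>R r v"
    using eq by (simp add: lin_scaleR scaleR_add_right)
  then show ?case
    unfolding reducible_def by (rule bexI[OF bexI[OF _ elts_scaleR[OF r, of c]] elts_scaleR[OF s, of c]])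
qed

lemma reducible_mono:
  assumes "reducible i d K x" "K \<subseteq> K'"
  shows "reducible i d K' x"
proof -
  have "lifts i K \<subseteq> lifts i K'"
    using assms(2) by (auto simp: lifts_def)
  moreover obtain s r where s: "s \<in> elts (lifts i K)" and r: "r \<in> elts {q \<in> basis i. stable q}"
    and eq: "\<forall>v. x v = lin i d s v + r v"
    using assms(1) unfolding reducible_def by blast
  ultimately have "s \<in> elts (lifts i K')"
    by (blast intro: elts_mono)
  with eq r show ?thesis
    unfolding reducible_def by blast
qed

text \<open>An unstable vector is the leading term of the image of its partner; the difference has
  strictly smaller keys, so induction on keys applies and the bound is inherited.\<close>

lemma reducible_unit_vec:
  assumes "triangular i d" "p \<in> basis i"
  shows "reducible i d (below (key p)) (unit_vec p)"
  using assms(2)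
proof (induction rule: basis_induct)
  case (less p)
  obtain k w where p: "p = (k, w)" by (cases p)
  show ?case
  proof (cases "stable p")
    case True
    then show ?thesis
      unfolding reducible_def
      by (intro bexI[of _ "\<lambda>v. 0"] bexI[of _ "unit_vec p"]) (use less.hyps in auto)
  next
    case False
    then obtain h y where hy: "h \<in> H" "y # w \<in> chains (Suc i)" "stable (h, y # w)" "k = h + g y"
      using unstable_cases[of k w i] less.hyps unfolding p by metis
    define x where "x = (\<lambda>v. lin i d (unit_vec (h, y # w)) v - unit_vec (h + g y, w) v)"
    have b: "(h, y # w) \<in> basis (Suc i)"
      using hy by (simp add: basis_def)
    have "x \<in> elts {q \<in> basis i. key_less (key q) (key p)}"
      unfolding x_def p hy(4) by (rule lin_stable[OF assms(1) b hy(3)])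
    then have "reducible i d (below (key p)) x"
    proof (rule reducible_elts)
      fix q assume "q \<in> {q \<in> basis i. key_less (key q) (key p)}"
      then have q: "q \<in> basis i" "key_less (key q) (key p)"
        by simp_all
      show "reducible i d (below (key p)) (unit_vec q)"
        by (rule reducible_mono[OF less.IH[OF q] below_mono[OF q(2)]])
    qed blast
    then obtain s r where sr: "s \<in> elts (lifts i (below (key p)))" "r \<in> elts {q \<in> basis i. stable q}"
      "\<And>v. x v = lin i d s v + r v"
      unfolding reducible_def by blast
    have "unit_vec (h, y # w) \<in> elts (lifts i (below (key p)))"
      using b hy lift_key_eq[OF b hy(3)] by (simp add: lifts_def below_def p)
    then have s': "(\<lambda>v. unit_vec (h, y # w) v - s v) \<in> elts (lifts i (below (key p)))"
      using sr by (intro elts_diff)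
    have r': "(\<lambda>v. 0 - r v) \<in> elts {q \<in> basis i. stable q}"
      using sr by (intro elts_diff) auto
    have "\<forall>v. unit_vec p v = lin i d (\<lambda>v. unit_vec (h, y # w) v - s v) v + (0 - r v)"
      using sr(3) by (simp add: lin_diff x_def p hy(4) algebra_simps)
    then show ?thesis
      unfolding reducible_def by (rule bexI[OF bexI[OF _ r'] s'])
  qed
qed

lemma reducible_if_triangular:
  assumes "triangular i d" "x \<in> elts {p \<in> basis i. below (key p) \<subseteq> K}"
  shows "reducible i d K x"
  using assms(2)
proof (rule reducible_elts)
  fix p assume "p \<in> {p \<in> basis i. below (key p) \<subseteq> K}"
  then show "reducible i d K (unit_vec p)"
    using reducible_mono[OF reducible_unit_vec[OF assms(1)]] by simp
qed blast

lemma below_subset: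
  assumes "\<mu> \<in> below \<kappa>"
  shows "below \<mu> \<subseteq> below \<kappa>"
proof -
  have "\<mu> = \<kappa> \<or> key_less \<mu> \<kappa>"
    using assms by (simp add: below_def)
  then show ?thesis
    using below_mono by blast
qed

text \<open>Distinct stable vectors have distinct partners, hence distinct leading terms. At a term
  of \<open>s\<close> with maximal \<open>lift_key\<close> nothing can cancel the leading
  term.\<close>

lemma lin_stable_inj:
  assumes "triangular i d" "s \<in> elts {q \<in> basis (Suc i). stable q}" "lin i d s = (\<lambda>v. 0)"
  shows "s = (\<lambda>v. 0)"
proof (rule ccontr)
  assume ne: "s \<noteq> (\<lambda>v. 0)"
  have s: "s \<in> elts (basis (Suc i))"
    using assms(2) by (rule elts_mono) auto
  have fin: "finite (terms s)"
    using s by (rule finite_terms)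
  have "terms s \<noteq> {}"
  proof
    assume "terms s = {}"
    then have "s v = 0" for v
      using sum_terms[OF s, of v] by simp
    then show False
      using ne by auto
  qed
  then obtain p where p: "p \<in> terms s" "\<And>q. q \<in> terms s \<Longrightarrow> \<not> key_less (lift_key p) (lift_key q)"
  proof -
    let ?R = "\<lambda>a b. key_less (lift_key a) (lift_key b)"
    have "asymp_on (terms s) ?R"
      by (rule asymp_onI) (metis key_less_trans key_less_irrefl)
    moreover have "transp_on (terms s) ?R"
      by (rule transp_onI) (metis key_less_trans)
    ultimately have "\<exists>p\<in>terms s. \<forall>q\<in>terms s. q \<noteq> p \<longrightarrow> \<not> ?R p q"
      by (intro Finite_Set.bex_max_element fin \<open>terms s \<noteq> {}\<close>)
    then show ?thesis
      using that key_less_irrefl by metis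
  qed
  have st: "q \<in> basis (Suc i)" "stable q" if "q \<in> terms s" for q
    using that assms(2) by (auto simp: elts_def)
  obtain h y w where pe: "p = (h, y # w)"
    using st(1)[OF p(1)] by (auto simp: basis_def elim: chains_SucE)
  define k where "k = h + g y"
  have b: "(k, w) \<in> basis i"
    using st(1)[OF p(1)]
    by (auto simp: pe k_def basis_def Cons_in_chains intro!: H_add dest: subsetD[OF state_letters])
  have lp: "lift_key p = key (k, w)"
    using lift_key_eq[of h y w i] st[OF p(1)] by (simp add: pe k_def)
  \<comment> \<open>Maximality of \<open>lift_key p\<close> keeps \<open>(k, w)\<close> out of the
    lower terms of every \<open>q\<close>; only leading terms can contribute.\<close>
  have coeff: "Poly_Mapping.lookup (lin i d (unit_vec q) w) k = (if q = p then 1 else 0)" if q: "q \<in> terms s" for q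
  proof -
    obtain h' y' w' where qe: "q = (h', y' # w')"
      using st(1)[OF q] by (auto simp: basis_def elim: chains_SucE)
    have lq: "lift_key q = key (h' + g y', w')"
      using lift_key_eq[of h' y' w' i] st[OF q] by (simp add: qe)
    have "Poly_Mapping.lookup (lin i d (unit_vec q) w - unit_vec (h' + g y', w') w) k = 0"
      using lin_stable[OF assms(1)] st[OF q] p(2)[OF q] unfolding qe lq[unfolded qe] lp elts_iff by blast
    moreover have "(h' + g y', w') = (k, w) \<longleftrightarrow> q = p"
    proof
      assume eq: "(h' + g y', w') = (k, w)"
      have in': "h' \<in> H" "h \<in> H" "y' # w' \<in> chains (Suc i)" "y # w \<in> chains (Suc i)"
        using st(1)[OF q] st(1)[OF p(1)] by (auto simp: qe pe basis_def)
      \<comment> \<open>If \<open>y\<close> and \<open>y'\<close> differed, each would be a letter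
        of the other monomial. Both lie in the state of \<open>w\<close>, so stability of the two
        pairs would give both inequalities between them.\<close>
      have "add_mset y' (nf h') = add_mset y (nf h)"
        using nf_add_letter(1)[OF in'(1,3)] nf_add_letter(1)[OF in'(2,4)] st(2)[OF q] st(2)[OF p(1)] eq
        by (simp add: qe pe k_def)
      moreover have "\<not> y < y'" if "y \<in># nf h'"
        using that st(2)[OF q] eq in'(4) by (auto simp: qe stable_def Cons_in_chains)
      moreover have "\<not> y' < y" if "y' \<in># nf h"
        using that st(2)[OF p(1)] eq in'(3) by (auto simp: pe stable_def Cons_in_chains)
      moreover have "y = y' \<or> y \<in># nf h' \<and> y' \<in># nf h"
        using calculation(1) by (metis insert_iff set_mset_add_mset_insert)
      ultimately have "y = y'"
        by (metis linorder_less_linear)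
      then show "q = p"
        using eq by (simp add: qe pe k_def)
    qed (simp add: qe pe k_def)
    ultimately show ?thesis
      by (simp add: lookup_minus lookup_unit_vec)
  qed
  have "0 = Poly_Mapping.lookup (lin i d s w) k"
    using assms(3) by simp
  also have "lin i d s w = lin i d (\<lambda>v. \<Sum>q\<in>terms s. Poly_Mapping.lookup (s (snd q)) (fst q) *\<^sub>R unit_vec q v) w"
    by (simp only: sum_terms[OF s, symmetric])
  also have "\<dots> = (\<Sum>q\<in>terms s. Poly_Mapping.lookup (s (snd q)) (fst q) *\<^sub>R lin i d (unit_vec q) w)"
    using fin by (simp add: lin_sum lin_scaleR)
  also have "Poly_Mapping.lookup \<dots> k =
      (\<Sum>q\<in>terms s. if q = p then Poly_Mapping.lookup (s (snd p)) (fst p) else 0)"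
    unfolding lookup_sum by (intro sum.cong) (auto simp: lookup_scaleR_poly_mapping coeff)
  also have "\<dots> = Poly_Mapping.lookup (s (snd p)) (fst p)"
    using fin p(1) by simp
  finally show False
    using p(1) by (simp add: terms_def)
qed

text \<open>The correction \<open>t\<close> has the same image as \<open>g y\<close> times the basis
  vector of the shorter word, so two consecutive differentials compose to zero. The set
  \<open>below\<close> is cut off at an upper bound for the keys in that image. That such a
  \<open>t\<close> exists is part of the induction in \<open>resolves\<close>.\<close>

primrec diff :: "nat \<Rightarrow> 'x list \<Rightarrow> 'x list \<Rightarrow> ('k \<Rightarrow>\<^sub>0 real)" where
  "diff 0 w = unit_vec (g (hd w), tl w)"
| "diff (Suc i) w = (\<lambda>v. unit_vec (g (hd w), tl w) v -
     (SOME t. t \<in> elts (lifts i (below (mset w, tl (tl w)))) \<and>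
        lin i (diff i) t = (\<lambda>v. Poly_Mapping.single (g (hd w)) 1 * diff i (tl w) v)) v)"

text \<open>The kernel of the map that leaves the \<open>i\<close>-th module; at index 0 this map is
  the augmentation, which takes the constant coefficient.\<close>

primrec cycle :: "nat \<Rightarrow> ('x list \<Rightarrow> ('k \<Rightarrow>\<^sub>0 real)) \<Rightarrow> bool" where
  "cycle 0 x \<longleftrightarrow> Poly_Mapping.lookup (x []) 0 = 0"
| "cycle (Suc i) x \<longleftrightarrow> lin i (diff i) x = (\<lambda>v. 0)"

lemma cycle_diff: "cycle i x \<Longrightarrow> cycle i y \<Longrightarrow> cycle i (\<lambda>v. x v - y v)"
  by (cases i) (auto simp: lookup_minus lin_diff fun_eq_iff)

text \<open>The state of the empty word is all of \<open>X\<close>, so the only stable monomial is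
  the constant one, and its coefficient is the augmentation.\<close>

lemma cycle_stable_zero_0:
  assumes "x \<in> elts {q \<in> basis 0. stable q}" "cycle 0 x"
  shows "x = (\<lambda>v. 0)"
proof -
  have "terms x = {}"
  proof (rule ccontr)
    assume "terms x \<noteq> {}"
    then obtain h w where hw: "(h, w) \<in> terms x"
      by auto
    then have *: "(h, w) \<in> basis 0" "stable (h, w)"
      using assms(1) by (auto simp: elts_def)
    then have [simp]: "w = []" and h: "h \<in> H"
      by (auto simp: basis_def)
    then have "nf h = {#}"
      using *(2) nf_letters[OF h] by (auto simp: stable_def)
    then show False
      using hw assms(2) nf_eq_empty[OF h] by (simp add: terms_def)
  qed
  then show ?thesis
    by (auto simp: terms_def fun_eq_iff intro!: poly_mapping_eqI)
qed

text \<open>Sizes of normal forms add up in products, so a constant term would have to come from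
  constant terms of both factors.\<close>

lemma cycle_lin_0:
  assumes "\<And>w. w \<in> chains (Suc 0) \<Longrightarrow> diff 0 w \<in> elts (basis 0) \<and> cycle 0 (diff 0 w)"
    and "x \<in> elts (basis (Suc 0))"
  shows "cycle 0 (lin 0 (diff 0) x)"
proof -
  have "Poly_Mapping.lookup (x w * diff 0 w []) 0 = 0" if w: "w \<in> chains (Suc 0)" for w
  proof (rule ccontr)
    assume "Poly_Mapping.lookup (x w * diff 0 w []) 0 \<noteq> 0"
    then obtain a b where ab: "a \<in> Poly_Mapping.keys (x w)" "b \<in> Poly_Mapping.keys (diff 0 w [])" "0 = a + b"
      using keys_mult[of "x w" "diff 0 w []"] by (auto simp: in_keys_iff)
    have "a \<in> H" "b \<in> H"
      using ab assms(2) assms(1)[OF w] by (auto simp: elts_iff basis_def in_keys_iff)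
    then have "nf b = {#}"
      using size_nf_add[of a b] ab(3) by simp
    then have "b = 0"
      using \<open>b \<in> H\<close> by (simp add: nf_eq_empty)
    then show False
      using ab(2) assms(1)[OF w] by (simp add: in_keys_iff)
  qed
  then show ?thesis
    by (simp add: lin_def lookup_sum)
qed

lemma lin_lin:
  "lin i d (lin (Suc i) e x) v = (\<Sum>w\<in>chains (Suc (Suc i)). x w * lin i d (e w) v)"
proof -
  have "lin i d (lin (Suc i) e x) v =
      (\<Sum>u\<in>chains (Suc i). \<Sum>w\<in>chains (Suc (Suc i)). x w * (e w u * d u v))"
    by (simp add: lin_def sum_distrib_right mult.assoc)
  also have "\<dots> = (\<Sum>w\<in>chains (Suc (Suc i)). \<Sum>u\<in>chains (Suc i). x w * (e w u * d u v))"
    by (rule sum.swap)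
  finally show ?thesis
    by (simp add: lin_def sum_distrib_left)
qed

definition resolves :: "nat \<Rightarrow> bool" where
  "resolves i \<longleftrightarrow> triangular i (diff i) \<and>
     (\<forall>w\<in>chains (Suc i). diff i w \<in> elts (basis i) \<and> cycle i (diff i w)) \<and>
     (\<forall>x\<in>elts {q \<in> basis i. stable q}. cycle i x \<longrightarrow> x = (\<lambda>v. 0))"

lemma cycle_lin:
  assumes "resolves i" "x \<in> elts (basis (Suc i))"
  shows "cycle i (lin i (diff i) x)"
proof (cases i)
  case 0
  then show ?thesis
    using assms cycle_lin_0 unfolding resolves_def by blast
next
  case (Suc j)
  have "lin j (diff j) (diff i w) = (\<lambda>v. 0)" if "w \<in> chains (Suc i)" for w
    using assms(1) that by (simp add: resolves_def Suc del: diff.simps)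
  then show ?thesis
    by (simp add: Suc lin_lin fun_eq_iff del: diff.simps)
qed

text \<open>Divide \<open>x\<close> by images. The remainder is stable, and it is a cycle because
  images are, so it vanishes by the last clause of \<open>resolves\<close>; the quotient is a
  preimage that respects the bound.\<close>

lemma exact_bounded:
  assumes "resolves i" "x \<in> elts {p \<in> basis i. below (key p) \<subseteq> K}" "cycle i x"
  shows "\<exists>t\<in>elts (lifts i K). lin i (diff i) t = x"
proof -
  obtain s r where s: "s \<in> elts (lifts i K)" and r: "r \<in> elts {q \<in> basis i. stable q}"
    and eq: "\<forall>v. x v = lin i (diff i) s v + r v"
    using reducible_if_triangular[OF _ assms(2), of "diff i"] assms(1)
    unfolding resolves_def reducible_def by blast
  have "s \<in> elts (basis (Suc i))"
    using s by (rule elts_mono) (auto simp: lifts_def)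
  then have "cycle i (\<lambda>v. x v - lin i (diff i) s v)"
    by (intro cycle_diff assms(3) cycle_lin[OF assms(1)])
  then have "cycle i r"
    using eq by simp
  then have "r = (\<lambda>v. 0)"
    using assms(1) r unfolding resolves_def by blast
  then show ?thesis
    using eq s by (intro bexI[of _ s]) auto
qed

lemma triangular_elts:
  assumes "triangular i d" "w \<in> chains (Suc i)"
  shows "d w \<in> elts {q \<in> basis i. key q \<in> below (key (g (hd w), tl w))}"
proof -
  obtain y u where w: "w = y # u" and yu: "u \<in> chains i" "y \<in> X"
    using assms(2) by (rule chains_SucE)
  let ?P = "{q \<in> basis i. key q \<in> below (key (g (hd w), tl w))}"
  have "(\<lambda>v. d w v - unit_vec (g y, u) v) \<in> elts {q \<in> basis i. key_less (key q) (key (g y, u))}"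
    using assms unfolding triangular_def w by blast
  then have "(\<lambda>v. d w v - unit_vec (g y, u) v) \<in> elts ?P"
    by (rule elts_mono) (auto simp: below_def w)
  moreover have "unit_vec (g y, u) \<in> elts ?P"
    using yu by (simp add: w basis_def below_def)
  ultimately have "(\<lambda>v. (d w v - unit_vec (g y, u) v) + unit_vec (g y, u) v) \<in> elts ?P"
    by (rule elts_add)
  then show ?thesis
    by simp
qed

text \<open>
  Terms with the same letters and the same truncated word \<open>tl w = w0\<close> as the leading one are the
  delicate case: then \<open>y\<close> and \<open>x0\<close> are compatible, \<open>y < x0\<close> both lie in the state of \<open>w0\<close>, and the
  matching, which removes the smallest such letter, removes \<open>y\<close> rather than \<open>x0\<close>.
\<close>

lemma correction_elts:
  assumes "y # w \<in> chains (Suc (Suc i))" "t \<in> elts (lifts i (below (mset (y # w), tl w)))"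
  shows "t \<in> elts {q \<in> basis (Suc i). key_less (key q) (key (g y, w))}"
  using assms(2)
proof (rule elts_mono, intro subsetI CollectI conjI)
  fix q assume "q \<in> lifts i (below (mset (y # w), tl w))"
  then have q: "q \<in> basis (Suc i)" "stable q" "lift_key q \<in> below (mset (y # w), tl w)"
    by (auto simp: lifts_def)
  show "q \<in> basis (Suc i)" by fact
  obtain n x u where qe: "q = (n, x # u)" and n: "n \<in> H" "x # u \<in> chains (Suc i)"
    using q(1) by (cases q) (auto simp: basis_def chains_def length_Suc_conv)
  obtain x0 w0 where we: "w = x0 # w0"
    using assms(1) by (auto simp: chains_def length_Suc_conv)
  have y: "y \<in> X" "x0 \<in> X" "w0 \<in> chains i" "y \<in> state w" "x0 \<in> state w0"
    using assms(1) state_letters by (auto simp: we Cons_in_chains)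
  have len: "length u = i" "length w0 = i"
    using n y by (auto simp: chains_def)
  consider (less) "mset_less (nf n + mset (x # u)) (mset (y # w))"
    | (word) "nf n + mset (x # u) = mset (y # w)" "rev u < rev w0"
    | (eq) "nf n + mset (x # u) = mset (y # w)" "u = w0"
    using q(3) by (auto simp: qe we lift_key_def below_def key_less_def)
  then show "key_less (key q) (key (g y, w))"
  proof cases
    case less
    then show ?thesis
      using y by (simp add: key_def qe key_less_def)
  next
    case word
    then show ?thesis
      using y len by (simp add: key_def qe key_less_def we append_less_append)
  next
    case eq
    then have sum: "add_mset x (nf n) = {#y, x0#}"
      by (simp add: we)
    then have nfx: "nf (n + g x) = {#y, x0#}"
      using nf_add_letter(1)[OF n] q(2) by (simp add: qe)
    have "n + g x \<in> H"
      using n by (auto simp: Cons_in_chains intro!: H_add dest: subsetD[OF state_letters])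
    then have "good y x0"
      using normal_nf[of "n + g x"] unfolding nfx normal_def by blast
    \<comment> \<open>As \<open>y\<close> and \<open>x0\<close> are compatible, \<open>y\<close> can
      belong to \<open>state (x0 # w0)\<close> only through the first half of that set.\<close>
    then have "y < x0" "y \<in> state w0"
      using y(4) by (auto simp: we)
    moreover have "x = y \<or> y \<in># nf n"
      using sum by (metis insert_iff set_mset_add_mset_insert)
    moreover have "\<not> (y \<in># nf n \<and> y < x)"
      using q(2) eq(2) \<open>y \<in> state w0\<close> by (auto simp: qe stable_def)
    moreover have "x = y \<or> x = x0"
      using sum by (metis insert_iff set_mset_add_mset_insert set_mset_single singletonD)
    ultimately have "x < x0"
      by blast
    then show ?thesis
      using y eq by (simp add: key_def qe key_less_def we append_less_append)
  qed
qed

text \<open>The keys of \<open>diff i w\<close> are at most its leading key; multiplication by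
  \<open>y\<close> adds \<open>y\<close> to both multisets, and rewriting lowers keys further. The
  resulting bound is the one built into \<open>diff\<close>.\<close>

lemma letter_mult_diff_elts:
  assumes "resolves i" "y # w \<in> chains (Suc (Suc i))"
  shows "(\<lambda>v. Poly_Mapping.single (g y) 1 * diff i w v)
    \<in> elts {p \<in> basis i. below (key p) \<subseteq> below (mset (y # w), tl w)}"
proof -
  have w: "w \<in> chains (Suc i)" and y: "y \<in> X"
    using assms(2) state_letters by (auto simp: Cons_in_chains)
  obtain x0 w0 where we: "w = x0 # w0" and x0: "x0 \<in> X"
    using w by (rule chains_SucE)
  have "(\<lambda>v. Poly_Mapping.single (g y) 1 * diff i w v) \<in>
     elts ((\<lambda>(k, v). (g y + k, v)) ` {q \<in> basis i. key q \<in> below (key (g (hd w), tl w))})"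
    using assms(1) w unfolding resolves_def by (intro elts_single_mult triangular_elts) auto
  then show ?thesis
  proof (rule elts_mono, safe)
    fix k v \<mu> a assume kv: "(k, v) \<in> basis i" and b: "key (k, v) \<in> below (key (g (hd w), tl w))"
    then show "(g y + k, v) \<in> basis i"
      using y H_add by (auto simp: basis_def)
    have k: "k \<in> H"
      using kv by (simp add: basis_def)
    have 1: "({#y#} + (nf k + mset v), v) \<in> below (mset (y # w), tl w)"
      using b key_less_add[of "nf k + mset v" v "mset w" w0 "{#y#}"] x0
      by (auto simp: we key_def below_def add_mset_commute[of x0])
    have "nf (g y + k) + mset v = {#y#} + (nf k + mset v) \<or>
        mset_less (nf (g y + k) + mset v) ({#y#} + (nf k + mset v))"
      using nf_add[of "g y" k] mset_less_add[of "nf (g y + k)" "nf (g y) + nf k" "mset v"] y k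
      by (auto simp: ac_simps)
    then have "key (g y + k, v) \<in> below ({#y#} + (nf k + mset v), v)"
      by (auto simp: key_def below_def key_less_def)
    then have "below (key (g y + k, v)) \<subseteq> below (mset (y # w), tl w)"
      using 1 by (meson below_subset order_trans)
    moreover assume "(\<mu>, a) \<in> below (key (g y + k, v))"
    ultimately show "(\<mu>, a) \<in> below (mset (y # w), tl w)"
      by blast
  qed
qed

lemma resolves: "resolves i"
proof (induction i)
  case 0
  have "diff 0 w \<in> elts (basis 0) \<and> cycle 0 (diff 0 w)" if w: "w \<in> chains (Suc 0)" for w
  proof -
    obtain y where "w = [y]" "y \<in> X"
      using w by (auto elim: chains_SucE)
    moreover have "g y \<noteq> 0" if "y \<in> X" for y
      using nf_g[OF that] nf_zero by auto
    ultimately show ?thesis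
      by (auto simp: basis_def lookup_unit_vec)
  qed
  then show ?case
    using cycle_stable_zero_0 by (simp add: resolves_def triangular_def)
next
  case (Suc i)
  have step: "\<exists>t. diff (Suc i) (y # w) = (\<lambda>v. unit_vec (g y, w) v - t v) \<and>
      t \<in> elts (lifts i (below (mset (y # w), tl w))) \<and>
      lin i (diff i) t = lin i (diff i) (unit_vec (g y, w))"
    if yw: "y # w \<in> chains (Suc (Suc i))" for y w
  proof -
    have w: "w \<in> chains (Suc i)" and y: "y \<in> X"
      using yw state_letters by (auto simp: Cons_in_chains)
    let ?x = "\<lambda>v. Poly_Mapping.single (g y) 1 * diff i w v"
    have lin: "lin i (diff i) (unit_vec (g y, w)) = ?x"
      using w by (simp add: lin_unit_vec fun_eq_iff)
    have "unit_vec (g y, w) \<in> elts (basis (Suc i))"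
      using w y by (simp add: basis_def)
    then have "cycle i ?x"
      using cycle_lin[OF Suc.IH] lin by metis
    \<comment> \<open>Bounded exactness one level down supplies the correction, so the choice in the
      definition of \<open>diff\<close> is a genuine one.\<close>
    then have "\<exists>t. t \<in> elts (lifts i (below (mset (y # w), tl w))) \<and> lin i (diff i) t = ?x"
      using exact_bounded[OF Suc.IH letter_mult_diff_elts[OF Suc.IH yw]] by blast
    from someI_ex[OF this] show ?thesis
      unfolding lin by (intro exI conjI) (auto simp del: mset.simps)
  qed
  have "triangular (Suc i) (diff (Suc i))"
    unfolding triangular_def
  proof (intro allI impI)
    fix y w assume yw: "y # w \<in> chains (Suc (Suc i))"
    obtain t where t: "diff (Suc i) (y # w) = (\<lambda>v. unit_vec (g y, w) v - t v)"
      "t \<in> elts (lifts i (below (mset (y # w), tl w)))"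
      using step[OF yw] by blast
    have "(\<lambda>v. 0 - t v) \<in> elts {q \<in> basis (Suc i). key_less (key q) (key (g y, w))}"
      using correction_elts[OF yw t(2)] by (intro elts_diff) auto
    then show "(\<lambda>v. diff (Suc i) (y # w) v - unit_vec (g y, w) v)
        \<in> elts {q \<in> basis (Suc i). key_less (key q) (key (g y, w))}"
      unfolding t(1) by simp
  qed
  moreover have "diff (Suc i) w \<in> elts (basis (Suc i))" if "w \<in> chains (Suc (Suc i))" for w
    by (rule elts_mono[OF triangular_elts[OF calculation that]]) auto
  moreover have "cycle (Suc i) (diff (Suc i) w)" if chain: "w \<in> chains (Suc (Suc i))" for w
  proof -
    obtain y u where w: "w = y # u"
      using chain by (auto simp: chains_def length_Suc_conv)
    obtain t where t: "diff (Suc i) w = (\<lambda>v. unit_vec (g y, u) v - t v)"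
      "lin i (diff i) t = lin i (diff i) (unit_vec (g y, u))"
      using step[of y u] chain unfolding w by blast
    show ?thesis
      unfolding t(1) by (simp add: t(2) lin_diff fun_eq_iff)
  qed
  \<comment> \<open>A cycle at this level is an element of the kernel of
    \<open>lin i (diff i)\<close>, and this map is injective on stable vectors.\<close>
  moreover have "x = (\<lambda>v. 0)" if "x \<in> elts {q \<in> basis (Suc i). stable q}" "cycle (Suc i) x" for x
    using lin_stable_inj[of i "diff i" x] that Suc.IH by (simp add: resolves_def)
  ultimately show ?case
    unfolding resolves_def by blast
qed

lemma exact:
  assumes "x \<in> elts (basis i)" "cycle i x"
  shows "\<exists>t\<in>elts (basis (Suc i)). lin i (diff i) t = x"
proof -
  have "\<exists>t\<in>elts (lifts i UNIV). lin i (diff i) t = x"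
    using assms by (intro exact_bounded resolves) auto
  moreover have "elts (lifts i UNIV) \<subseteq> elts (basis (Suc i))"
    by (auto simp: elts_def lifts_def)
  ultimately show ?thesis
    by blast
qed

lemma cycle_lin_diff: "x \<in> elts (basis (Suc i)) \<Longrightarrow> cycle i (lin i (diff i) x)"
  by (intro cycle_lin resolves)

text \<open>All terms carry as many letters as the leading one, and words in \<open>chains i\<close>
  use \<open>i\<close> of them, so one letter remains for the coefficient. This is the linearity of
  the resolution.\<close>

lemma diff_elts: "w \<in> chains (Suc i) \<Longrightarrow> diff i w \<in> elts {q \<in> basis i. size (nf (fst q)) = 1}"
proof -
  assume w: "w \<in> chains (Suc i)"
  obtain y u where yu: "w = y # u" "u \<in> chains i" "y \<in> X"
    using w by (rule chains_SucE)
  have "diff i w \<in> elts {q \<in> basis i. key q \<in> below (key (g (hd w), tl w))}"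
    using resolves[of i] w by (intro triangular_elts) (auto simp: resolves_def)
  then show ?thesis
  proof (rule elts_mono, intro subsetI CollectI conjI)
    fix q assume q: "q \<in> {q \<in> basis i. key q \<in> below (key (g (hd w), tl w))}"
    then show "q \<in> basis i" by simp
    have "size (nf (fst q) + mset (snd q)) = size ({#y#} + mset u)"
      using q yu by (auto simp: below_def key_def key_less_def mset_less_def dest: arg_cong[of _ _ size])
    then show "size (nf (fst q)) = 1"
      using q yu(2) by (auto simp: basis_def chains_def)
  qed
qed

section \<open>The monomial algebra and its standard grading\<close>

definition algebra :: "('k \<Rightarrow>\<^sub>0 real) set" where
  "algebra = {f. Poly_Mapping.keys f \<subseteq> H}"

definition component :: "nat \<Rightarrow> ('k \<Rightarrow>\<^sub>0 real) set" where
  "component m = {f. Poly_Mapping.keys f \<subseteq> {h \<in> H. size (nf h) = m}}"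

lemma H_0: "{h \<in> H. size (nf h) = 0} = {0}"
  using nf_eq_empty by auto

lemma H_1: "{h \<in> H. size (nf h) = 1} = g ` X"
proof -
  have "h \<in> g ` X" if "h \<in> H" "size (nf h) = 1" for h
  proof -
    obtain x where "nf h = {#x#}"
      using \<open>size (nf h) = 1\<close> size_1_singleton_mset by blast
    then show ?thesis
      using monom_nf[OF that(1)] nf_letters[OF that(1)] by auto
  qed
  then show ?thesis
    by auto
qed

lemma component_subset: "component m \<subseteq> algebra"
  by (auto simp: component_def algebra_def)

lemma mult_in_component:
  assumes "x \<in> component m" "y \<in> component n"
  shows "x * y \<in> component (m + n)"
proof -
  have "Poly_Mapping.keys (x * y) \<subseteq> {a + b |a b. a \<in> Poly_Mapping.keys x \<and> b \<in> Poly_Mapping.keys y}"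
    by (rule keys_mult)
  also have "\<dots> \<subseteq> {h \<in> H. size (nf h) = m + n}"
    using assms by (auto simp: component_def size_nf_add intro!: H_add dest!: subsetD)
  finally show ?thesis
    by (simp add: component_def)
qed

lemma mult_in_algebra: "x \<in> algebra \<Longrightarrow> y \<in> algebra \<Longrightarrow> x * y \<in> algebra"
  unfolding algebra_def using keys_mult[of x y] H_add by fastforce

lemma subalgebra_algebra: "subalgebra algebra"
  using subspace_keys[of H] mult_in_algebra unfolding subalgebra_def by (auto simp: algebra_def)

lemma algebra_generated_letters:
  "algebra_generated ((\<lambda>x. Poly_Mapping.single (g x) 1) ` X) = algebra"
  unfolding algebra_generated_def
proof (rule hull_unique)
  show "(\<lambda>x. Poly_Mapping.single (g x) 1) ` X \<subseteq> algebra"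
    by (auto simp: algebra_def)
  show "subalgebra algebra"
    by (rule subalgebra_algebra)
  fix B assume B: "(\<lambda>x. Poly_Mapping.single (g x) (1::real)) ` X \<subseteq> B" "subalgebra B"
  have "Poly_Mapping.single (monom \<alpha>) 1 \<in> B" if "set_mset \<alpha> \<subseteq> X" for \<alpha>
    using that
  proof (induction \<alpha>)
    case empty
    then show ?case
      using B(2) by (simp add: subalgebra_def)
  next
    case (add x \<alpha>)
    then have "Poly_Mapping.single (g x) 1 * Poly_Mapping.single (monom \<alpha>) 1 \<in> B"
      using B by (auto simp: subalgebra_def)
    then show ?case
      by (simp add: mult_single monom_def)
  qed
  then have "(\<lambda>k. Poly_Mapping.single k (1::real)) ` H \<subseteq> B"
    by (auto simp: H_def)
  then have "span ((\<lambda>k. Poly_Mapping.single k (1::real)) ` H) \<subseteq> B"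
    using B(2) by (intro span_minimal) (auto simp: subalgebra_def)
  then show "algebra \<subseteq> B"
    by (simp add: span_single_eq algebra_def)
qed

lemma component_1: "component 1 = span ((\<lambda>x. Poly_Mapping.single (g x) 1) ` X)"
proof -
  have "(\<lambda>x. Poly_Mapping.single (g x) (1::real)) ` X = (\<lambda>k. Poly_Mapping.single k 1) ` g ` X"
    by auto
  then show ?thesis
    by (simp only: component_def H_1 span_single_eq)
qed

lemma algebra_generated_component_1: "algebra = algebra_generated (component 1)"
proof (rule subset_antisym)
  have "(\<lambda>x. Poly_Mapping.single (g x) (1::real)) ` X \<subseteq> component 1"
    unfolding component_1 by (rule span_superset)
  then show "algebra \<subseteq> algebra_generated (component 1)"
    unfolding algebra_generated_letters[symmetric] unfolding algebra_generated_def by (rule hull_mono)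
  show "algebra_generated (component 1) \<subseteq> algebra"
    unfolding algebra_generated_def by (rule hull_minimal) (rule component_subset subalgebra_algebra)+
qed

definition part :: "('k \<Rightarrow>\<^sub>0 real) \<Rightarrow> nat \<Rightarrow> ('k \<Rightarrow>\<^sub>0 real)" where
  "part a m = (\<Sum>k\<in>{k \<in> Poly_Mapping.keys a. size (nf k) = m}. Poly_Mapping.single k (Poly_Mapping.lookup a k))"

lemma lookup_part: "Poly_Mapping.lookup (part a m) k = (if size (nf k) = m then Poly_Mapping.lookup a k else 0)"
proof -
  have "Poly_Mapping.lookup (part a m) k =
      (\<Sum>l\<in>{k \<in> Poly_Mapping.keys a. size (nf k) = m}. if l = k then Poly_Mapping.lookup a k else 0)"
    unfolding part_def lookup_sum by (intro sum.cong) (auto simp: lookup_single)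
  then show ?thesis
    by (simp add: in_keys_iff)
qed

lemma graded: "graded_algebra algebra component"
  unfolding graded_algebra_def
proof (intro conjI allI ballI)
  show "subalgebra algebra"
    by (rule subalgebra_algebra)
  show "subspace (component m)" for m
    unfolding component_def by (rule subspace_keys)
  show "component m \<subseteq> algebra" for m
    by (rule component_subset)
  show "x * y \<in> component (m + n)" if "x \<in> component m" "y \<in> component n" for m n x y
    using that by (rule mult_in_component)
  fix a assume a: "a \<in> algebra"
  have sub: "{m. part a m \<noteq> 0} \<subseteq> (\<lambda>k. size (nf k)) ` Poly_Mapping.keys a"
  proof
    fix m assume "m \<in> {m. part a m \<noteq> 0}"
    then have "\<exists>k. Poly_Mapping.lookup (part a m) k \<noteq> 0"
      by (metis (mono_tags) mem_Collect_eq poly_mapping_eqI lookup_zero)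
    then show "m \<in> (\<lambda>k. size (nf k)) ` Poly_Mapping.keys a"
      by (auto simp: lookup_part in_keys_iff split: if_splits)
  qed
  have fin: "finite {m. part a m \<noteq> 0}"
    by (rule finite_subset[OF sub]) simp
  show "\<exists>!f. (\<forall>m. f m \<in> component m) \<and> finite {m. f m \<noteq> 0} \<and> a = (\<Sum>m | f m \<noteq> 0. f m)"
  proof (rule ex1I)
    have "a = (\<Sum>m | part a m \<noteq> 0. part a m)"
    proof (rule poly_mapping_eqI)
      fix k
      have "Poly_Mapping.lookup (\<Sum>m | part a m \<noteq> 0. part a m) k =
          (\<Sum>m | part a m \<noteq> 0. if m = size (nf k) then Poly_Mapping.lookup a k else 0)"
        unfolding lookup_sum by (intro sum.cong) (auto simp: lookup_part)
      also have "\<dots> = Poly_Mapping.lookup a k"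
      proof (cases "part a (size (nf k)) = 0")
        case True
        then have "Poly_Mapping.lookup a k = 0"
          using lookup_part[of a "size (nf k)" k] by simp
        then show ?thesis
          by (simp cong: if_cong)
      qed (use fin in auto)
      finally show "Poly_Mapping.lookup a k = Poly_Mapping.lookup (\<Sum>m | part a m \<noteq> 0. part a m) k"
        by simp
    qed
    moreover have "part a m \<in> component m" for m
      using a by (auto simp: component_def algebra_def in_keys_iff lookup_part split: if_splits)
    ultimately show "(\<forall>m. part a m \<in> component m) \<and> finite {m. part a m \<noteq> 0} \<and>
        a = (\<Sum>m | part a m \<noteq> 0. part a m)"
      using fin by blast
    fix f assume f: "(\<forall>m. f m \<in> component m) \<and> finite {m. f m \<noteq> 0} \<and> a = (\<Sum>m | f m \<noteq> 0. f m)"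
    show "f = part a"
    proof (intro ext poly_mapping_eqI)
      fix m k
      have deg: "size (nf k) = m" if "Poly_Mapping.lookup (f m) k \<noteq> 0" for m
      proof -
        have "f m \<in> component m"
          using f by blast
        then show ?thesis
          using that by (auto simp: component_def in_keys_iff subset_iff)
      qed
      have "Poly_Mapping.lookup a k = (\<Sum>m | f m \<noteq> 0. Poly_Mapping.lookup (f m) k)"
        using f by (metis lookup_sum)
      also have "\<dots> = (\<Sum>m | f m \<noteq> 0. if m = size (nf k) then Poly_Mapping.lookup (f (size (nf k))) k else 0)"
        using deg by (intro sum.cong) auto
      also have "\<dots> = Poly_Mapping.lookup (f (size (nf k))) k"
        using f by auto
      finally show "Poly_Mapping.lookup (f m) k = Poly_Mapping.lookup (part a m) k"
        using deg by (auto simp: lookup_part)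
    qed
  qed
qed

lemma standard: "standard_graded algebra component"
  unfolding standard_graded_def
proof (intro conjI)
  show "component 0 = range of_real"
  proof
    show "range of_real \<subseteq> component 0"
      by (auto simp: component_def H_0 of_real_eq_single split: if_splits)
    show "component 0 \<subseteq> range of_real"
    proof
      fix f assume "f \<in> component 0"
      then have "f = Poly_Mapping.single 0 (Poly_Mapping.lookup f 0)"
        unfolding component_def H_0
        by (intro poly_mapping_eqI) (auto simp: lookup_single when_def in_keys_iff)
      then show "f \<in> range of_real"
        unfolding of_real_eq_single by blast
    qed
  qed
  show "\<exists>B. finite B \<and> component 1 = span B"
    using component_1 finite_letters by blast
qed (use graded algebra_generated_component_1 in auto)

text \<open>The set \<open>M\<close> serves two uses: \<open>UNIV\<close> gives plain membership, a
  singleton gives homogeneity.\<close>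

lemma lin_elts:
  assumes "x \<in> elts {p \<in> basis (Suc i). size (nf (fst p)) \<in> M}"
  shows "lin i (diff i) x \<in> elts {p \<in> basis i. size (nf (fst p)) \<in> Suc ` M}"
  unfolding elts_iff
proof (intro allI impI)
  fix h v assume "Poly_Mapping.lookup (lin i (diff i) x v) h \<noteq> 0"
  then obtain w where w: "w \<in> chains (Suc i)" "Poly_Mapping.lookup (x w * diff i w v) h \<noteq> 0"
    unfolding lin_def lookup_sum by (meson sum.neutral)
  then obtain a b where ab: "a \<in> Poly_Mapping.keys (x w)" "b \<in> Poly_Mapping.keys (diff i w v)" "h = a + b"
    using keys_mult[of "x w" "diff i w v"] by (auto simp: in_keys_iff)
  have "a \<in> H" "size (nf a) \<in> M"
    using ab(1) assms by (auto simp: elts_iff in_keys_iff basis_def)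
  moreover have "b \<in> H" "v \<in> chains i" "size (nf b) = 1"
    using ab(2) diff_elts[OF w(1)] by (auto simp: elts_iff in_keys_iff basis_def)
  ultimately show "(h, v) \<in> {p \<in> basis i. size (nf (fst p)) \<in> Suc ` M}"
    using ab(3) by (auto simp: basis_def size_nf_add H_add)
qed

section \<open>Numbered bases and the linear resolution\<close>

definition rank :: "nat \<Rightarrow> nat" where
  "rank i = card (chains i)"

definition nth_chain :: "nat \<Rightarrow> nat \<Rightarrow> 'x list" where
  "nth_chain i = (SOME f. bij_betw f {..<rank i} (chains i))"

lemma nth_chain: "bij_betw (nth_chain i) {..<rank i} (chains i)"
  unfolding nth_chain_def rank_def
  using ex_bij_betw_nat_finite[OF finite_chains, of i] unfolding atLeast0LessThan by (rule someI_ex)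

text \<open>Resolutions are defined with basis vectors numbered by natural numbers, while the
  construction indexes them by chains; \<open>to_words\<close> and \<open>of_words\<close> translate
  along a chosen numbering.\<close>

definition to_words :: "nat \<Rightarrow> (nat \<Rightarrow> ('k \<Rightarrow>\<^sub>0 real)) \<Rightarrow> 'x list \<Rightarrow> ('k \<Rightarrow>\<^sub>0 real)" where
  "to_words i x = (\<lambda>w. if w \<in> chains i then x (the_inv_into {..<rank i} (nth_chain i) w) else 0)"

definition of_words :: "nat \<Rightarrow> ('x list \<Rightarrow> ('k \<Rightarrow>\<^sub>0 real)) \<Rightarrow> nat \<Rightarrow> ('k \<Rightarrow>\<^sub>0 real)" where
  "of_words i x = (\<lambda>j. if j < rank i then x (nth_chain i j) else 0)"

lemma inv_chain:
  assumes "w \<in> chains i"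
  shows "the_inv_into {..<rank i} (nth_chain i) w < rank i"
    "nth_chain i (the_inv_into {..<rank i} (nth_chain i) w) = w"
  using assms nth_chain[of i] the_inv_into_into[of "nth_chain i" "{..<rank i}" w "{..<rank i}"]
    f_the_inv_into_f_bij_betw[of "nth_chain i" "{..<rank i}" "chains i" w]
  by (auto simp: bij_betw_def)

lemma to_words_elts:
  assumes "\<And>j. j < rank i \<Longrightarrow> Poly_Mapping.keys (x j) \<subseteq> {h \<in> H. size (nf h) \<in> M}"
  shows "to_words i x \<in> elts {p \<in> basis i. size (nf (fst p)) \<in> M}"
  unfolding elts_iff
proof (intro allI impI)
  fix h w assume "Poly_Mapping.lookup (to_words i x w) h \<noteq> 0"
  then have "w \<in> chains i" "h \<in> Poly_Mapping.keys (x (the_inv_into {..<rank i} (nth_chain i) w))"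
    by (auto simp: to_words_def in_keys_iff split: if_splits)
  then show "(h, w) \<in> {p \<in> basis i. size (nf (fst p)) \<in> M}"
    using assms[OF inv_chain(1)] by (auto simp: basis_def)
qed

lemma of_words_keys:
  assumes "x \<in> elts {p \<in> basis i. size (nf (fst p)) \<in> M}"
  shows "Poly_Mapping.keys (of_words i x j) \<subseteq> {h \<in> H. size (nf h) \<in> M}"
  using assms by (auto simp: elts_iff of_words_def basis_def in_keys_iff split: if_splits)

lemma to_words_of_words:
  assumes "x \<in> elts (basis i)"
  shows "to_words i (of_words i x) = x"
proof
  fix w
  have "x w = 0" if "w \<notin> chains i"
    using assms that by (intro poly_mapping_eqI) (auto simp: elts_iff basis_def)
  then show "to_words i (of_words i x) w = x w"
    by (simp add: to_words_def of_words_def inv_chain)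
qed

lemma of_words_to_words: "x \<in> free_module algebra (rank i) \<Longrightarrow> of_words i (to_words i x) = x"
  using nth_chain[of i]
  by (auto simp: fun_eq_iff to_words_def of_words_def free_module_def bij_betw_def the_inv_into_f_f)

lemma to_words_in_elts: "x \<in> free_module algebra (rank i) \<Longrightarrow> to_words i x \<in> elts (basis i)"
  using to_words_elts[of i x UNIV] by (simp add: free_module_def algebra_def)

lemma of_words_in_free_module: "x \<in> elts (basis i) \<Longrightarrow> of_words i x \<in> free_module algebra (rank i)"
proof -
  assume x: "x \<in> elts (basis i)"
  have "of_words i x j \<in> algebra" for j
    using of_words_keys[of x i UNIV j] x by (simp add: algebra_def)
  moreover have "of_words i x j = 0" if "rank i \<le> j" for j
    using that by (simp add: of_words_def)
  ultimately show ?thesis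
    by (simp add: free_module_def)
qed

lemma lin_in_elts: "x \<in> elts (basis (Suc i)) \<Longrightarrow> lin i (diff i) x \<in> elts (basis i)"
  using lin_elts[of x i UNIV] by (auto elim: elts_mono)

lemma to_words_add: "to_words i (\<lambda>j. x j + y j) = (\<lambda>w. to_words i x w + to_words i y w)"
  and to_words_mult: "to_words i (\<lambda>j. a * x j) = (\<lambda>w. a * to_words i x w)"
  by (auto simp: to_words_def)

lemma of_words_add: "of_words i (\<lambda>j. x j + y j) = (\<lambda>w. of_words i x w + of_words i y w)"
  and of_words_mult: "of_words i (\<lambda>j. a * x j) = (\<lambda>w. a * of_words i x w)"
  by (auto simp: of_words_def)

definition boundary :: "nat \<Rightarrow> (nat \<Rightarrow> ('k \<Rightarrow>\<^sub>0 real)) \<Rightarrow> nat \<Rightarrow> ('k \<Rightarrow>\<^sub>0 real)" where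
  "boundary i x = of_words i (lin i (diff i) (to_words (Suc i) x))"

lemma boundary_hom:
  "graded_hom algebra component (rank (Suc i)) (\<lambda>_. Suc i) (rank i) (\<lambda>_. i) (boundary i)"
  unfolding graded_hom_def
proof (intro conjI ballI allI)
  show "boundary i x \<in> free_module algebra (rank i)" if "x \<in> free_module algebra (rank (Suc i))" for x
    unfolding boundary_def using that
    by (intro of_words_in_free_module lin_in_elts to_words_in_elts)
  show "boundary i (\<lambda>j. x j + y j) = (\<lambda>j. boundary i x j + boundary i y j)" for x y
    unfolding boundary_def to_words_add of_words_add[symmetric] by (simp add: lin_add[abs_def])
  show "boundary i (\<lambda>j. a * x j) = (\<lambda>j. a * boundary i x j)" for a x
    unfolding boundary_def to_words_mult of_words_mult[symmetric] by (simp add: lin_mult[abs_def])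
  fix n x assume x: "x \<in> free_component component (rank (Suc i)) (\<lambda>_. Suc i) n"
  show "boundary i x \<in> free_component component (rank i) (\<lambda>_. i) n"
  proof (cases "Suc i \<le> n")
    case True
    then have "x j \<in> component (n - Suc i)" if "j < rank (Suc i)" for j
      using x that by (auto simp: free_component_def dest!: spec[of _ j])
    then have "to_words (Suc i) x \<in> elts {p \<in> basis (Suc i). size (nf (fst p)) \<in> {n - Suc i}}"
      by (intro to_words_elts) (simp add: component_def)
    then have "Poly_Mapping.keys (boundary i x j) \<subseteq> {h \<in> H. size (nf h) \<in> Suc ` {n - Suc i}}" for j
      unfolding boundary_def by (intro of_words_keys lin_elts)
    \<comment> \<open>Here \<open>Suc (n - Suc i) = n - i\<close>: the degree-one entries compensate
      for the drop in the degree of the basis vectors.\<close>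
    then have "boundary i x j \<in> component (n - i)" for j
      using True by (simp add: component_def Suc_diff_Suc Suc_le_eq)
    moreover have "boundary i x j = 0" if "\<not> j < rank i" for j
      using that by (simp add: boundary_def of_words_def)
    ultimately show ?thesis
      using True by (simp add: free_component_def)
  next
    case False
    then have "x = (\<lambda>j. 0)"
      using x by (auto simp: free_component_def)
    then have "to_words (Suc i) x = (\<lambda>v. 0)"
      by (auto simp: to_words_def)
    then have "boundary i x = (\<lambda>j. 0)"
      by (auto simp: boundary_def of_words_def)
    then show ?thesis
      by (simp add: free_component_def component_def)
  qed
qed

definition augment :: "(nat \<Rightarrow> ('k \<Rightarrow>\<^sub>0 real)) \<Rightarrow> real" where
  "augment x = Poly_Mapping.lookup (to_words 0 x []) 0"

lemma augment_pos:
  assumes "a \<in> component m" "y \<in> algebra" "0 < m"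
  shows "Poly_Mapping.lookup (a * y) 0 = 0"
proof (rule ccontr)
  assume "Poly_Mapping.lookup (a * y) 0 \<noteq> 0"
  then obtain k l where kl: "k \<in> Poly_Mapping.keys a" "l \<in> Poly_Mapping.keys y" "0 = k + l"
    using keys_mult[of a y] by (auto simp: in_keys_iff)
  then have "size (nf k) = m" "size (nf (k + l)) = size (nf k) + size (nf l)"
    using assms size_nf_add[of k l] by (auto simp: component_def algebra_def)
  then show False
    using kl assms(3) by simp
qed

lemma augmentation_augment: "augmentation algebra component (rank 0) (\<lambda>_. 0) augment"
  unfolding augmentation_def
proof (intro conjI ballI allI impI)
  show "augment (\<lambda>j. x j + y j) = augment x + augment y" for x y
    by (simp add: augment_def to_words_add lookup_add)
  show "augment (\<lambda>j. of_real c * x j) = c * augment x" for c x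
    unfolding augment_def to_words_mult
    by (simp add: lookup_scaleR_poly_mapping flip: scaleR_conv_of_real)
  have alg: "to_words 0 x [] \<in> algebra" if "x \<in> free_module algebra (rank 0)" for x
    using to_words_in_elts[OF that] by (auto simp: elts_iff basis_def algebra_def in_keys_iff)
  show "augment (\<lambda>j. a * x j) = 0" if "0 < m" "a \<in> component m" "x \<in> free_module algebra (rank 0)" for m a x
    using augment_pos[OF that(2) alg[OF that(3)] that(1)] by (simp add: augment_def to_words_mult)
  fix n :: nat and x assume n: "0 < n" and x: "x \<in> free_component component (rank 0) (\<lambda>_. 0) n"
  have "x j \<in> component n" if "j < rank 0" for j
    using x that by (auto simp: free_component_def dest!: spec[of _ j])
  then have "to_words 0 x \<in> elts {p \<in> basis 0. size (nf (fst p)) \<in> {n}}"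
    by (intro to_words_elts) (simp add: component_def)
  then show "augment x = 0"
    using n nf_zero by (fastforce simp: elts_iff augment_def)
qed

lemma boundary_eq_0_iff:
  assumes "x \<in> free_module algebra (rank (Suc i))"
  shows "boundary i x = (\<lambda>j. 0) \<longleftrightarrow> cycle (Suc i) (to_words (Suc i) x)"
proof -
  have "lin i (diff i) (to_words (Suc i) x) \<in> elts (basis i)"
    using assms by (intro lin_in_elts to_words_in_elts)
  from to_words_of_words[OF this] have "boundary i x = (\<lambda>j. 0) \<Longrightarrow> lin i (diff i) (to_words (Suc i) x) = (\<lambda>v. 0)"
    unfolding boundary_def by (auto simp: to_words_def)
  then show ?thesis
    by (auto simp: boundary_def of_words_def)
qed

lemma boundary_image:
  "boundary i ` free_module algebra (rank (Suc i)) = {x \<in> free_module algebra (rank i). cycle i (to_words i x)}"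
proof (intro equalityI subsetI)
  fix x assume "x \<in> boundary i ` free_module algebra (rank (Suc i))"
  then obtain y where y: "y \<in> free_module algebra (rank (Suc i))" "x = boundary i y"
    by blast
  have l: "lin i (diff i) (to_words (Suc i) y) \<in> elts (basis i)"
    using y by (intro lin_in_elts to_words_in_elts)
  then have "cycle i (to_words i x)"
    using y by (simp add: boundary_def to_words_of_words cycle_lin_diff to_words_in_elts)
  then show "x \<in> {x \<in> free_module algebra (rank i). cycle i (to_words i x)}"
    using y l by (simp add: boundary_def of_words_in_free_module)
next
  fix x assume "x \<in> {x \<in> free_module algebra (rank i). cycle i (to_words i x)}"
  then have x: "x \<in> free_module algebra (rank i)" "cycle i (to_words i x)"
    by auto
  then obtain t where t: "t \<in> elts (basis (Suc i))" "lin i (diff i) t = to_words i x"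
    using exact to_words_in_elts by blast
  have "boundary i (of_words (Suc i) t) = x"
    using t x by (simp add: boundary_def to_words_of_words of_words_to_words)
  then show "x \<in> boundary i ` free_module algebra (rank (Suc i))"
    using of_words_in_free_module[OF t(1)] by blast
qed

theorem koszul_algebra: "koszul algebra component"
proof -
  have "c \<in> augment ` free_module algebra (rank 0)" for c
  proof
    let ?x = "\<lambda>v. c *\<^sub>R unit_vec (0, []) v"
    have x: "?x \<in> elts (basis 0)"
      by (intro elts_scaleR) (simp add: basis_def)
    then show "of_words 0 ?x \<in> free_module algebra (rank 0)"
      by (rule of_words_in_free_module)
    show "c = augment (of_words 0 ?x)"
      by (simp add: augment_def to_words_of_words[OF x] lookup_scaleR_poly_mapping lookup_unit_vec)
  qed
  moreover have "{x \<in> free_module algebra (rank 0). augment x = 0} = boundary 0 ` free_module algebra (rank 1)"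
    using boundary_image[of 0] by (simp add: augment_def)
  moreover have "{x \<in> free_module algebra (rank (Suc i)). boundary i x = (\<lambda>j. 0)} =
      boundary (Suc i) ` free_module algebra (rank (Suc (Suc i)))" for i
    using boundary_image[of "Suc i"] boundary_eq_0_iff[of _ i] by (auto simp del: cycle.simps)
  ultimately have "graded_free_resolution algebra component rank (\<lambda>i _. i) boundary augment"
    unfolding graded_free_resolution_def using boundary_hom augmentation_augment by blast
  then show ?thesis
    unfolding koszul_def has_linear_resolution_def
    by (intro conjI standard exI[of _ rank] exI[of _ "\<lambda>i _. i"] exI[of _ boundary] exI[of _ augment]) auto
qed

end

section \<open>Balanced languages\<close>

definition expo :: "'a list \<Rightarrow> 'a \<Rightarrow>\<^sub>0 nat" where
  "expo q = (\<Sum>x\<leftarrow>q. Poly_Mapping.single x 1)"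

definition word_sum :: "'a list set \<Rightarrow> ('a \<Rightarrow>\<^sub>0 nat) \<Rightarrow>\<^sub>0 real" where
  "word_sum W = (\<Sum>q\<in>W. Poly_Mapping.single (expo q) 1)"

lemma expo_Nil [simp]: "expo [] = 0"
  and expo_append: "expo (q @ r) = expo q + expo r"
  by (simp_all add: expo_def)

lemma lookup_expo: "Poly_Mapping.lookup (expo q) x = count (mset q) x"
  by (induction q) (auto simp: expo_def lookup_add lookup_single)

lemma expo_eq_iff: "expo q = expo r \<longleftrightarrow> mset q = mset r"
  by (auto simp: poly_mapping_eq_iff fun_eq_iff lookup_expo multiset_eq_iff)

lemma lookup_sum_single:
  "finite Y \<Longrightarrow> Poly_Mapping.lookup (\<Sum>z\<in>Y. Poly_Mapping.single (f z) (1::real)) k = real (card {z \<in> Y. f z = k})"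
proof -
  assume "finite Y"
  have "Poly_Mapping.lookup (\<Sum>z\<in>Y. Poly_Mapping.single (f z) (1::real)) k = (\<Sum>z\<in>Y. if f z = k then 1 else 0)"
    unfolding lookup_sum by (intro sum.cong) (auto simp: lookup_single when_def)
  also have "\<dots> = real (card {z \<in> Y. f z = k})"
    using \<open>finite Y\<close> by (simp add: sum.If_cases Int_def)
  finally show ?thesis .
qed

text \<open>Coefficients are cardinalities, so nothing cancels and a monomial on one side must occur
  on the other.\<close>

lemma sum_single_eq_imp_ex:
  assumes "finite Y" "finite Y'" "z \<in> Y"
    and "(\<Sum>z\<in>Y. Poly_Mapping.single (f z) (1::real)) = (\<Sum>z\<in>Y'. Poly_Mapping.single (f' z) 1)"
  shows "\<exists>z'\<in>Y'. f' z' = f z"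
proof -
  have "card {y \<in> Y. f y = f z} \<noteq> 0"
    using assms by auto
  moreover have "real (card {y \<in> Y. f y = f z}) = real (card {y \<in> Y'. f' y = f z})"
    unfolding lookup_sum_single[OF assms(1), symmetric] lookup_sum_single[OF assms(2), symmetric] assms(4) ..
  ultimately have "card {y \<in> Y'. f' y = f z} \<noteq> 0"
    by linarith
  then show ?thesis
    by (metis (mono_tags, lifting) Collect_empty_eq card.empty)
qed

lemma word_sum_mult:
  "finite A \<Longrightarrow> finite B \<Longrightarrow>
    word_sum A * word_sum B = (\<Sum>(q, r)\<in>A \<times> B. Poly_Mapping.single (expo q + expo r) 1)"
  by (simp add: word_sum_def sum_product sum.cartesian_product mult_single)

lemma word_sum_nonzero: "finite A \<Longrightarrow> A \<noteq> {} \<Longrightarrow> word_sum A \<noteq> 0"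
proof
  assume A: "finite A" "A \<noteq> {}" and "word_sum A = 0"
  then obtain q where q: "q \<in> A" by blast
  have "Poly_Mapping.lookup (word_sum A) (expo q) = real (card {r \<in> A. expo r = expo q})"
    unfolding word_sum_def by (rule lookup_sum_single[OF A(1)])
  then show False
    using A q \<open>word_sum A = 0\<close> by auto
qed

lemma word_sum_append: "word_sum ((@) q ` W) = Poly_Mapping.single (expo q) 1 * word_sum W"
  by (simp add: word_sum_def sum.reindex inj_on_def sum_distrib_left mult_single expo_append)

text \<open>Vertices are represented by the label words that lead to them: \<open>rest L p\<close>
  stands for the paths from the vertex to the leaves, \<open>branches L p\<close> for its outgoing
  labels, and \<open>word_sum (rest L p)\<close> for its polynomial \<open>t\<close>.\<close>

definition rest :: "'a list set \<Rightarrow> 'a list \<Rightarrow> 'a list set" where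
  "rest L p = {q. p @ q \<in> L}"

definition branches :: "'a list set \<Rightarrow> 'a list \<Rightarrow> 'a set" where
  "branches L p = {a. \<exists>q. p @ a # q \<in> L}"

lemma finite_rest: "finite L \<Longrightarrow> finite (rest L p)"
proof -
  assume "finite L"
  moreover have "(@) p ` rest L p \<subseteq> L"
    by (auto simp: rest_def)
  ultimately have "finite ((@) p ` rest L p)"
    by (rule rev_finite_subset)
  then show ?thesis
    by (rule finite_imageD) (simp add: inj_on_def)
qed

lemma finite_branches: "finite L \<Longrightarrow> finite (branches L p)"
proof -
  assume "finite L"
  then have "finite (\<Union>(set ` L))"
    by auto
  moreover have "branches L p \<subseteq> \<Union>(set ` L)"
  proof
    fix a assume "a \<in> branches L p"
    then obtain q where "p @ a # q \<in> L"
      by (auto simp: branches_def)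
    moreover have "a \<in> set (p @ a # q)"
      by simp
    ultimately show "a \<in> \<Union>(set ` L)"
      by blast
  qed
  ultimately show ?thesis
    by (rule rev_finite_subset)
qed

lemma append_less_append_left [simp]:
  fixes us :: "'x::linorder list"
  shows "us @ xs < us @ ys \<longleftrightarrow> xs < ys"
  by (induction us) auto

lemma concat_eq_append_Cons:
  "concat ls = u @ x # t \<Longrightarrow> \<exists>A p s C. ls = A @ (p @ x # s) # C \<and> u = concat A @ p \<and> t = s @ concat C"
proof (induction ls arbitrary: u)
  case Nil
  then show ?case by simp
next
  case (Cons l ls)
  have step: ?case if eq: "u = l @ v" "concat ls = v @ x # t" for v
  proof -
    obtain A p s C where "ls = A @ (p @ x # s) # C" "v = concat A @ p" "t = s @ concat C"
      using Cons.IH[OF eq(2)] by blast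
    then show ?thesis
      using eq(1) by (intro exI[of _ "l # A"] exI[of _ p] exI[of _ s] exI[of _ C]) simp
  qed
  from Cons.prems consider v where "l = u @ v" "v @ concat ls = x # t"
    | v where "u = l @ v" "concat ls = v @ x # t"
    by (auto simp: append_eq_append_conv2)
  then show ?case
  proof cases
    case (1 v)
    show ?thesis
    proof (cases "v = []")
      case True
      then show ?thesis
        using step[of "[]"] 1 by simp
    next
      case False
      then obtain s where "v = x # s"
        using 1(2) by (cases v) auto
      then show ?thesis
        using 1 by (intro exI[of _ "[]"] exI[of _ u] exI[of _ s] exI[of _ ls]) simp
    qed
  next
    case (2 v)
    then show ?thesis
      by (rule step)
  qed
qed

text \<open>In a sorted list the smaller of two entries comes before the larger, so a condition on
  ordered pairs of positions becomes one on two-element submultisets.\<close>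

lemma pairs_iff_sorted_wrt:
  assumes "sorted ls"
  shows "(\<forall>x y. {#x, y#} \<subseteq># mset ls \<longrightarrow> R (min x y) (max x y)) \<longleftrightarrow> sorted_wrt R ls"
  using assms
proof (induction ls)
  case Nil
  then show ?case by simp
next
  case (Cons z ls)
  then have "min z y = z" "max z y = y" "min y z = z" "max y z = y" if "y \<in> set ls" for y
    using that by (auto simp: min_def max_def)
  then show ?case
    using Cons by (auto simp: pair_subset_add_mset)
qed

text \<open>Turns the polynomial identity into an equality of multisets of label multisets, a form
  that can be pushed forward along a renaming of labels.\<close>

lemma word_sum_mult_eq_iff:
  assumes "finite A" "finite B" "finite C" "finite D"
  shows "word_sum A * word_sum B = word_sum C * word_sum D \<longleftrightarrow>
    image_mset (\<lambda>(q, r). mset (q @ r)) (mset_set (A \<times> B)) =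
    image_mset (\<lambda>(q, r). mset (q @ r)) (mset_set (C \<times> D))"
proof -
  have mult: "Poly_Mapping.lookup (word_sum A * word_sum B) (expo s) =
      real (count (image_mset (\<lambda>(q, r). mset (q @ r)) (mset_set (A \<times> B))) (mset s))"
    if "finite A" "finite B" for A B :: "'a list set" and s
  proof -
    have "{z \<in> A \<times> B. (case z of (q, r) \<Rightarrow> expo q + expo r) = expo s} =
        {z \<in> A \<times> B. (case z of (q, r) \<Rightarrow> mset (q @ r)) = mset s}"
      by (simp add: case_prod_unfold expo_append[symmetric] expo_eq_iff)
    then show ?thesis
      using that by (simp add: word_sum_mult case_prod_unfold lookup_sum_single
          count_image_mset_eq_card_vimage)
  qed
  have zero: "Poly_Mapping.lookup (word_sum A * word_sum B) k = 0"
    if "finite A" "finite B" "k \<notin> range expo" for A B :: "'a list set" and k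
  proof -
    have "{z \<in> A \<times> B. (case z of (q, r) \<Rightarrow> expo q + expo r) = k} = {}"
      using that(3) by (auto simp flip: expo_append)
    then show ?thesis
      using that(1,2) by (simp add: word_sum_mult case_prod_unfold lookup_sum_single)
  qed
  show ?thesis
  proof
    assume eq: "word_sum A * word_sum B = word_sum C * word_sum D"
    show "image_mset (\<lambda>(q, r). mset (q @ r)) (mset_set (A \<times> B)) =
        image_mset (\<lambda>(q, r). mset (q @ r)) (mset_set (C \<times> D))"
    proof (rule multiset_eqI)
      fix M :: "'a multiset"
      obtain s where "M = mset s"
        using ex_mset by metis
      then show "count (image_mset (\<lambda>(q, r). mset (q @ r)) (mset_set (A \<times> B))) M =
          count (image_mset (\<lambda>(q, r). mset (q @ r)) (mset_set (C \<times> D))) M"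
        using mult[of A B s] mult[of C D s] assms eq by simp
    qed
  next
    assume eq: "image_mset (\<lambda>(q, r). mset (q @ r)) (mset_set (A \<times> B)) =
        image_mset (\<lambda>(q, r). mset (q @ r)) (mset_set (C \<times> D))"
    show "word_sum A * word_sum B = word_sum C * word_sum D"
    proof (rule poly_mapping_eqI)
      fix k
      show "Poly_Mapping.lookup (word_sum A * word_sum B) k = Poly_Mapping.lookup (word_sum C * word_sum D) k"
      proof (cases "k \<in> range expo")
        case True
        then show ?thesis
          using mult assms eq by auto
      next
        case False
        then show ?thesis
          using zero assms by metis
      qed
    qed
  qed
qed

text \<open>Injectivity on the words involved ensures that no two paths merge; the label multisets
  may be pushed forward by any map.\<close>

lemma word_sum_map:
  assumes eq: "word_sum A * word_sum B = word_sum C * word_sum D"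
    and fin: "finite A" "finite B" "finite C" "finite D"
    and inj: "inj_on (map f) (A \<union> B \<union> C \<union> D)"
  shows "word_sum (map f ` A) * word_sum (map f ` B) = word_sum (map f ` C) * word_sum (map f ` D)"
proof -
  have img: "image_mset (\<lambda>(q, r). mset (q @ r)) (mset_set (map f ` A \<times> map f ` B)) =
      image_mset (image_mset f) (image_mset (\<lambda>(q, r). mset (q @ r)) (mset_set (A \<times> B)))"
    if "inj_on (map f) (A \<union> B)" for A B
  proof -
    have "inj_on (map_prod (map f) (map f)) (A \<times> B)"
      using that by (auto simp: inj_on_def)
    from image_mset_mset_set[OF this]
    have "mset_set (map f ` A \<times> map f ` B) = image_mset (map_prod (map f) (map f)) (mset_set (A \<times> B))"
      by (simp add: map_prod_surj_on[of "map f" A _ "map f" B])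
    then show ?thesis
      by (simp add: multiset.map_comp o_def case_prod_unfold map_prod_def)
  qed
  have "inj_on (map f) (A \<union> B)" "inj_on (map f) (C \<union> D)"
    using inj by (auto intro: inj_on_subset)
  then have "image_mset (\<lambda>(q, r). mset (q @ r)) (mset_set (map f ` A \<times> map f ` B)) =
      image_mset (\<lambda>(q, r). mset (q @ r)) (mset_set (map f ` C \<times> map f ` D))"
    using eq[unfolded word_sum_mult_eq_iff[OF fin]] by (simp only: img)
  then show ?thesis
    using fin by (simp only: word_sum_mult_eq_iff finite_imageI)
qed

text \<open>The stage of an inner vertex is recorded only through its set of outgoing labels, which
  suffices because label sets of different stages are disjoint. Prefix-freeness says that leaves
  have no children.\<close>

locale staged_language =
  fixes L :: "nat list set"
  assumes finite_words: "finite L"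
    and prefix_free: "p \<in> L \<Longrightarrow> p @ q \<in> L \<Longrightarrow> q = []"
    and stages: "a \<in> branches L p \<Longrightarrow> a \<in> branches L q \<Longrightarrow> branches L p = branches L q"
    and balance: "branches L p = branches L q \<Longrightarrow> a \<in> branches L p \<Longrightarrow> b \<in> branches L p \<Longrightarrow>
      word_sum (rest L (p @ [a])) * word_sum (rest L (q @ [b])) =
      word_sum (rest L (p @ [b])) * word_sum (rest L (q @ [a]))"
begin

text \<open>On labels this is a partial equivalence: reflexive exactly on the labels that
  occur.\<close>

definition same_stage :: "nat \<Rightarrow> nat \<Rightarrow> bool" where
  "same_stage a b \<longleftrightarrow> (\<exists>p. a \<in> branches L p \<and> b \<in> branches L p)"

lemma same_stage_sym: "same_stage a b \<Longrightarrow> same_stage b a"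
  by (auto simp: same_stage_def)

lemma same_stage_branches: "a \<in> branches L p \<Longrightarrow> same_stage a b \<longleftrightarrow> b \<in> branches L p"
  unfolding same_stage_def using stages by blast

lemma same_stage_trans: "same_stage a b \<Longrightarrow> same_stage b c \<Longrightarrow> same_stage a c"
  unfolding same_stage_def using stages by blast

section \<open>Exchanging two labels of one stage\<close>

lemma branchesI: "p @ a # q \<in> L \<Longrightarrow> a \<in> branches L p"
  by (auto simp: branches_def)

text \<open>Read off one coefficient of the balance identity: the pair of completions
  \<open>(q, q')\<close> on one side forces a pair with the same labels in total on the
  other.\<close>

lemma swap_different:
  assumes "p @ a # q \<in> L" "p' @ b # q' \<in> L" "same_stage a b"
  shows "\<exists>r r'. p @ b # r \<in> L \<and> p' @ a # r' \<in> L \<and> mset r + mset r' = mset q + mset q'"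
proof -
  have a: "a \<in> branches L p" and b: "b \<in> branches L p'"
    using assms by (auto intro: branchesI)
  then have eq: "branches L p = branches L p'" "b \<in> branches L p"
    using assms(3) same_stage_branches stages by blast+
  let ?R = "\<lambda>p a. rest L (p @ [a])"
  have fin: "finite (?R p a)" for p a
    using finite_words by (rule finite_rest)
  have "(\<Sum>z\<in>?R p a \<times> ?R p' b. Poly_Mapping.single (case z of (q, r) \<Rightarrow> expo q + expo r) (1::real)) =
      (\<Sum>z\<in>?R p b \<times> ?R p' a. Poly_Mapping.single (case z of (q, r) \<Rightarrow> expo q + expo r) 1)"
    using balance[OF eq(1) a eq(2)] fin by (simp add: word_sum_mult case_prod_unfold)
  moreover have "(q, q') \<in> ?R p a \<times> ?R p' b"
    using assms by (simp add: rest_def)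
  ultimately obtain z where "z \<in> ?R p b \<times> ?R p' a" "(case z of (q, r) \<Rightarrow> expo q + expo r) = expo q + expo q'"
    using sum_single_eq_imp_ex[of "?R p a \<times> ?R p' b" "?R p b \<times> ?R p' a" "(q, q')"
        "\<lambda>(q, r). expo q + expo r" "\<lambda>(q, r). expo q + expo r"] fin
    by auto
  then show ?thesis
    using expo_eq_iff[of "_ @ _" "q @ q'"] by (cases z) (auto simp: rest_def expo_append)
qed

lemma word_sum_rest:
  assumes "branches L p \<noteq> {}"
  shows "word_sum (rest L p) =
    (\<Sum>a\<in>branches L p. Poly_Mapping.single (expo [a]) 1 * word_sum (rest L (p @ [a])))"
proof -
  have "[] \<notin> rest L p"
    using assms prefix_free[of p] by (auto simp: rest_def branches_def)
  have eq: "rest L p = (\<Union>a\<in>branches L p. (@) [a] ` rest L (p @ [a]))"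
  proof (intro equalityI subsetI)
    fix w assume w: "w \<in> rest L p"
    then obtain a v where "w = a # v"
      using \<open>[] \<notin> rest L p\<close> by (cases w) auto
    then show "w \<in> (\<Union>a\<in>branches L p. (@) [a] ` rest L (p @ [a]))"
      using w by (auto simp: rest_def branches_def)
  qed (auto simp: rest_def)
  have "word_sum (rest L p) = (\<Sum>a\<in>branches L p. word_sum ((@) [a] ` rest L (p @ [a])))"
    unfolding word_sum_def eq
    by (rule sum.UNION_disjoint) (auto simp: finite_branches finite_rest finite_words)
  then show ?thesis
    by (simp only: word_sum_append)
qed

text \<open>Choose a longest prefix with the given branches; finiteness of \<open>L\<close> bounds
  the lengths, and a label of the stage further down would lead to a longer one.\<close>

lemma deepest_prefix:
  assumes "branches L p \<noteq> {}"
  obtains p' where "branches L p' = branches L p"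
    "\<And>a w. w \<in> rest L (p' @ [a]) \<Longrightarrow> set w \<inter> branches L p = {}"
proof -
  let ?P = "{p'. branches L p' = branches L p}"
  have "finite (\<Union>w\<in>L. length ` {q. \<exists>r. w = q @ r})"
  proof (intro finite_UN_I finite_words)
    fix w
    show "finite (length ` {q. \<exists>r. w = q @ r})"
      by (rule finite_subset[of _ "{..length w}"]) auto
  qed
  moreover have "length ` ?P \<subseteq> (\<Union>w\<in>L. length ` {q. \<exists>r. w = q @ r})"
  proof clarify
    fix q assume "branches L q = branches L p"
    then obtain a r where "q @ a # r \<in> L"
      using assms unfolding branches_def by blast
    then show "length q \<in> (\<Union>w\<in>L. length ` {q. \<exists>r. w = q @ r})"
      by blast
  qed
  ultimately have fin: "finite (length ` ?P)"
    by (rule rev_finite_subset)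
  have "Max (length ` ?P) \<in> length ` ?P"
    using fin by (intro Max_in) auto
  then obtain p' where p': "branches L p' = branches L p" "length p' = Max (length ` ?P)"
    by auto
  have "set w \<inter> branches L p = {}" if "w \<in> rest L (p' @ [a])" for a w
  proof (rule ccontr)
    assume "set w \<inter> branches L p \<noteq> {}"
    then obtain x where "x \<in> set w" "x \<in> branches L p"
      by blast
    then obtain u v where x: "x \<in> branches L p" "w = u @ x # v"
      by (meson split_list)
    then have "x \<in> branches L (p' @ a # u)"
      using that by (auto simp: rest_def branches_def)
    then have "branches L (p' @ a # u) = branches L p"
      using x stages by blast
    then have "length (p' @ a # u) \<le> length p'"
      unfolding p'(2) using fin by (intro Max_ge imageI) simp_all
    then show False
      by simp
  qed
  then show ?thesis
    using that p' by blast
qed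

text \<open>
  The swap within one path is the point where balancedness is used as an identity of polynomials.
  Let \<open>X x y\<close> sum the monomials of the paths \<open>p x u y s\<close> without \<open>x\<close> and \<open>y\<close>, where \<open>u\<close> avoids the
  stage \<open>c\<close>. Compare \<open>p\<close> with a deepest vertex \<open>p'\<close> of the stage, below which no label of \<open>c\<close> occurs:
  the terms of the balance identity that contain labels of \<open>c\<close> give \<open>X a b * G = X b a * G\<close>, and
  \<open>G \<noteq> 0\<close> can be cancelled.
\<close>

lemma swap_same:
  assumes word: "p @ a # q @ b # s \<in> L" and ab: "same_stage a b" and q: "\<And>x. x \<in> set q \<Longrightarrow> \<not> same_stage a x"
  shows "\<exists>q' s'. p @ b # q' @ a # s' \<in> L \<and> mset q' + mset s' = mset q + mset s"
proof -
  define c where "c = branches L p"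
  have a: "a \<in> c"
    using word by (auto simp: c_def intro: branchesI)
  have c: "same_stage a x \<longleftrightarrow> x \<in> c" for x
    using a unfolding c_def by (rule same_stage_branches)
  have b: "b \<in> c"
    using ab c by simp
  obtain p' where p': "branches L p' = c" "\<And>l w. w \<in> rest L (p' @ [l]) \<Longrightarrow> set w \<inter> c = {}"
    using deepest_prefix[of p] a unfolding c_def by blast
  let ?T = "\<lambda>l. word_sum (rest L (p' @ [l]))"
  define F where "F x = {w \<in> rest L (p @ [x]). set w \<inter> c = {}}" for x
  define N where "N x = {w \<in> rest L (p @ [x]). set w \<inter> c \<noteq> {}}" for x
  \<comment> \<open>These are the segments from the edge \<open>x\<close> down to the next vertex of
    stage \<open>c\<close>.\<close>
  define Q where "Q x = {u. set u \<inter> c = {} \<and> branches L (p @ x # u) = c}" for x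
  define X where "X x y = (\<Sum>u\<in>Q x. Poly_Mapping.single (expo u) 1 * word_sum (rest L (p @ x # u @ [y])))" for x y
  let ?G = "word_sum (rest L p')"
  have fin: "finite (rest L r)" for r
    using finite_words by (rule finite_rest)
  have finF: "finite (F x)" "finite (N x)" for x
    using fin[of "p @ [x]"] by (simp_all add: F_def N_def)
  have key_sets: "Poly_Mapping.lookup (expo u) x = 0 \<longleftrightarrow> x \<notin> set u"
    "0 < Poly_Mapping.lookup (expo u) x \<longleftrightarrow> x \<in> set u" for u :: "nat list" and x
    by (simp_all add: lookup_expo)
  \<comment> \<open>No word below \<open>p'\<close> contains a label of \<open>c\<close>, so these
    products are the \<open>c\<close>-free part of the balance identity for \<open>p\<close> and
    \<open>p'\<close>.\<close>
  have "word_sum (F x) * ?T y = word_sum (F y) * ?T x" if xy: "x \<in> c" "y \<in> c" for x y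
  proof (rule poly_mapping_eqI)
    fix k :: "nat \<Rightarrow>\<^sub>0 nat"
    have eq: "Poly_Mapping.lookup (word_sum (F x) * ?T y) k =
      (if \<exists>l\<in>c. Poly_Mapping.lookup k l \<noteq> 0 then 0
       else Poly_Mapping.lookup (word_sum (rest L (p @ [x])) * ?T y) k)" for x y
    proof -
      have 1: "Poly_Mapping.lookup (word_sum (F x) * ?T y) k =
          real (card {z \<in> F x \<times> rest L (p' @ [y]). (case z of (u, v) \<Rightarrow> expo u + expo v) = k})"
        using finF fin by (simp add: word_sum_mult case_prod_unfold lookup_sum_single)
      have 2: "Poly_Mapping.lookup (word_sum (rest L (p @ [x])) * ?T y) k =
          real (card {z \<in> rest L (p @ [x]) \<times> rest L (p' @ [y]). (case z of (u, v) \<Rightarrow> expo u + expo v) = k})"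
        using fin by (simp add: word_sum_mult case_prod_unfold lookup_sum_single)
      show ?thesis
      proof (cases "\<exists>l\<in>c. Poly_Mapping.lookup k l \<noteq> 0")
        case True
        then have "{z \<in> F x \<times> rest L (p' @ [y]). (case z of (u, v) \<Rightarrow> expo u + expo v) = k} = {}"
          using p'(2) by (fastforce simp: F_def lookup_add key_sets)
        then show ?thesis
          using True by (simp only: 1 card.empty if_True of_nat_0)
      next
        case False
        then have "{z \<in> F x \<times> rest L (p' @ [y]). (case z of (u, v) \<Rightarrow> expo u + expo v) = k} =
            {z \<in> rest L (p @ [x]) \<times> rest L (p' @ [y]). (case z of (u, v) \<Rightarrow> expo u + expo v) = k}"
          by (auto simp: F_def lookup_add key_sets)
        then show ?thesis
          using False by (simp only: 1 2 if_False)
      qed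
    qed
    have "word_sum (rest L (p @ [x])) * ?T y = word_sum (rest L (p @ [y])) * ?T x"
      using balance[of p p' x y] p'(1) xy by (simp add: c_def)
    then show "Poly_Mapping.lookup (word_sum (F x) * ?T y) k = Poly_Mapping.lookup (word_sum (F y) * ?T x) k"
      by (simp only: eq)
  qed
  moreover have "word_sum (rest L (p @ [x])) = word_sum (F x) + word_sum (N x)" for x
  proof -
    have "rest L (p @ [x]) = F x \<union> N x"
      by (auto simp: F_def N_def)
    moreover have "F x \<inter> N x = {}"
      by (auto simp: F_def N_def)
    ultimately show ?thesis
      using sum.union_disjoint[OF finF] by (simp add: word_sum_def)
  qed
  ultimately have N_swap: "word_sum (N a) * ?T b = word_sum (N b) * ?T a"
    using balance[of p p' a b] p'(1) a b by (simp add: c_def distrib_right)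
  have finQ: "finite (Q x)" if "x \<in> c" for x
  proof (rule finite_subset)
    show "Q x \<subseteq> (\<Union>w\<in>rest L (p @ [x]). {u. \<exists>v. w = u @ v})"
    proof
      fix u assume "u \<in> Q x"
      then obtain y v where "p @ x # u @ y # v \<in> L"
        using a by (auto simp: Q_def branches_def)
      then show "u \<in> (\<Union>w\<in>rest L (p @ [x]). {u. \<exists>v. w = u @ v})"
        by (auto simp: rest_def)
    qed
    have "finite {u. \<exists>v. w = u @ v}" for w :: "nat list"
      by (rule finite_subset[OF _ finite_lists_length_le[of "set w" "length w"]]) auto
    then show "finite (\<Union>w\<in>rest L (p @ [x]). {u. \<exists>v. w = u @ v})"
      using fin by blast
  qed
  have N_X: "word_sum (N x) * ?T y = X x y * ?G" if xy: "x \<in> c" "y \<in> c" for x y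
  proof -
    have "N x = (\<Union>u\<in>Q x. (@) u ` rest L (p @ x # u))"
    proof (intro equalityI subsetI)
      fix w assume w: "w \<in> N x"
      then have "\<exists>l\<in>set w. l \<in> c"
        by (auto simp: N_def)
      then obtain u l v where uv: "w = u @ l # v" "l \<in> c" "\<forall>z\<in>set u. z \<notin> c"
        by (rule split_list_first_propE)
      then have "l \<in> branches L (p @ x # u)"
        using w by (auto simp: N_def rest_def branches_def)
      then have "u \<in> Q x"
        using uv stages[of l p] by (auto simp: Q_def c_def)
      moreover have "w \<in> (@) u ` rest L (p @ x # u)"
        using w uv by (auto simp: N_def rest_def)
      ultimately show "w \<in> (\<Union>u\<in>Q x. (@) u ` rest L (p @ x # u))"
        by blast
    next
      fix w assume "w \<in> (\<Union>u\<in>Q x. (@) u ` rest L (p @ x # u))"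
      then obtain u v where u: "u \<in> Q x" "v \<in> rest L (p @ x # u)" "w = u @ v"
        by blast
      have "v \<noteq> []"
      proof
        assume "v = []"
        moreover obtain z where "p @ x # u @ x # z \<in> L"
          using u(1) xy by (auto simp: Q_def branches_def)
        ultimately show False
          using u(2) prefix_free[of "p @ x # u" "x # z"] by (simp add: rest_def)
      qed
      then obtain l v' where v: "v = l # v'"
        by (cases v) auto
      then have "l \<in> branches L (p @ x # u)"
        using u by (auto simp: rest_def branches_def)
      then show "w \<in> N x"
        using u v by (auto simp: Q_def N_def rest_def)
    qed
    \<comment> \<open>If \<open>u\<close> were a proper prefix of \<open>u'\<close>, the next letter
      of \<open>u'\<close> would leave a vertex of stage \<open>c\<close>, but \<open>u'\<close>
      avoids \<open>c\<close>.\<close>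
    moreover have disj: "(@) u ` rest L (p @ x # u) \<inter> (@) u' ` rest L (p @ x # u') = {}"
      if "u \<in> Q x" "u' \<in> Q x" "u \<noteq> u'" for u u'
    proof -
      have False if eq: "u @ v = u' @ v'" "v \<in> rest L (p @ x # u)" "v' \<in> rest L (p @ x # u')"
        and Q: "u \<in> Q x" "u' \<in> Q x" and ne: "u \<noteq> u'" "length u \<le> length u'" for u u' v v'
      proof -
        obtain t' where t': "u' = u @ t'"
          using eq(1) ne by (auto simp: append_eq_append_conv2)
        then obtain l t where lt: "u' = u @ l # t"
          using ne by (cases t') auto
        then have "l \<in> branches L (p @ x # u)"
          using eq(1,2) by (auto simp: rest_def branches_def)
        then show False
          using Q lt by (auto simp: Q_def)
      qed
      then show ?thesis
        using \<open>u \<in> Q x\<close> \<open>u' \<in> Q x\<close> \<open>u \<noteq> u'\<close> by (auto) (metis nat_le_linear)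
    qed
    ultimately have "word_sum (N x) = (\<Sum>u\<in>Q x. word_sum ((@) u ` rest L (p @ x # u)))"
      unfolding word_sum_def using finQ[OF xy(1)] fin by (simp add: sum.UNION_disjoint)
    then have "word_sum (N x) * ?T y = (\<Sum>u\<in>Q x. Poly_Mapping.single (expo u) 1 * (word_sum (rest L (p @ x # u)) * ?T y))"
      by (simp add: word_sum_append sum_distrib_right mult.assoc)
    also have "\<dots> = (\<Sum>u\<in>Q x. Poly_Mapping.single (expo u) 1 * (word_sum (rest L (p @ x # u @ [y])) * ?G))"
    proof (intro sum.cong refl arg_cong[of _ _ "(*) _"])
      fix u assume "u \<in> Q x"
      then have u: "branches L (p @ x # u) = c"
        by (simp add: Q_def)
      have "branches L (p @ x # u) \<noteq> {}" "branches L p' \<noteq> {}"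
        using a u p'(1) by auto
      note eq = this[THEN word_sum_rest]
      have "word_sum (rest L (p @ x # u)) * ?T y =
          (\<Sum>l\<in>c. Poly_Mapping.single (expo [l]) 1 * (word_sum (rest L ((p @ x # u) @ [l])) * ?T y))"
        by (simp add: eq(1) u sum_distrib_right mult.assoc)
      \<comment> \<open>Balancedness of the vertex after \<open>u\<close> with \<open>p'\<close>
        moves the summation label \<open>l\<close> to the second factor, where the sum over all
        \<open>l\<close> builds up \<open>?G\<close>.\<close>
      also have "\<dots> = (\<Sum>l\<in>c. Poly_Mapping.single (expo [l]) 1 * (word_sum (rest L ((p @ x # u) @ [y])) * ?T l))"
        using balance[of "p @ x # u" p' _ y] u p'(1) xy by (intro sum.cong) auto
      also have "\<dots> = word_sum (rest L (p @ x # u @ [y])) * ?G"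
        by (simp add: eq(2) p'(1) sum_distrib_left mult.left_commute)
      finally show "word_sum (rest L (p @ x # u)) * ?T y = word_sum (rest L (p @ x # u @ [y])) * ?G" .
    qed
    finally show ?thesis
      by (simp add: X_def sum_distrib_right mult.assoc)
  qed
  have "X a b * ?G = X b a * ?G"
    using N_swap N_X[OF a b] N_X[OF b a] by simp
  moreover have "?G \<noteq> 0"
    using a p'(1) by (intro word_sum_nonzero fin) (auto simp: branches_def rest_def)
  ultimately have "X a b = X b a"
    by simp
  moreover have X: "X x y = (\<Sum>z\<in>Sigma (Q x) (\<lambda>u. rest L (p @ x # u @ [y])). Poly_Mapping.single (expo (fst z @ snd z)) 1)"
    if "x \<in> c" for x y
    unfolding X_def word_sum_def
    by (simp add: sum_distrib_left sum.Sigma finQ[OF that] fin mult_single expo_append case_prod_unfold)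
  moreover have "(q, s) \<in> Sigma (Q a) (\<lambda>u. rest L (p @ a # u @ [b]))"
  proof -
    have "b \<in> branches L (p @ a # q)"
      using word by (auto simp: branches_def)
    then have "branches L (p @ a # q) = c"
      using b stages unfolding c_def by blast
    then show ?thesis
      using q c word by (auto simp: Q_def rest_def)
  qed
  ultimately obtain z where "z \<in> Sigma (Q b) (\<lambda>u. rest L (p @ b # u @ [a]))" "expo (fst z @ snd z) = expo (q @ s)"
    using sum_single_eq_imp_ex[of "Sigma (Q a) (\<lambda>u. rest L (p @ a # u @ [b]))"
        "Sigma (Q b) (\<lambda>u. rest L (p @ b # u @ [a]))" "(q, s)" "\<lambda>z. expo (fst z @ snd z)" "\<lambda>z. expo (fst z @ snd z)"]
      finQ a b fin by auto
  then show ?thesis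
    by (cases z) (auto simp: rest_def expo_eq_iff)
qed

section \<open>Ordered tuples of words: uniqueness and existence\<close>

definition ordered :: "nat list \<Rightarrow> bool" where
  "ordered = sorted_wrt (\<lambda>a b. same_stage a b \<longrightarrow> a \<le> b)"

definition cross :: "nat list \<Rightarrow> nat list \<Rightarrow> bool" where
  "cross x y \<longleftrightarrow> (\<forall>a\<in>set x. \<forall>b\<in>set y. same_stage a b \<longrightarrow> a \<le> b)"

lemma ordered_concat: "ordered (concat ls) \<longleftrightarrow> (\<forall>x\<in>set ls. ordered x) \<and> sorted_wrt cross ls"
  by (induction ls) (auto simp: ordered_def cross_def sorted_wrt_append)

text \<open>Take an inversion with the fewest letters in between: a letter of the same stage there
  would form a closer inversion with one of the two ends. The clean gap is what
  \<open>swap_same\<close> requires.\<close>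

lemma not_orderedE:
  assumes "\<not> ordered xs"
  obtains u a q b v where "xs = u @ a # q @ b # v" "same_stage a b" "b < a"
    "\<And>x. x \<in> set q \<Longrightarrow> \<not> same_stage a x"
proof -
  define P where "P n \<longleftrightarrow> (\<exists>u a q b v. xs = u @ a # q @ b # v \<and> same_stage a b \<and> b < a \<and> length q = n)" for n
  have "\<exists>n. P n"
  proof -
    obtain i j where ij: "i < j" "j < length xs" "same_stage (xs ! i) (xs ! j)" "xs ! j < xs ! i"
      using assms unfolding ordered_def sorted_wrt_iff_nth_less by auto
    have "xs = take i xs @ xs ! i # take (j - Suc i) (drop (Suc i) xs) @ xs ! j # drop (Suc j) xs"
      using ij id_take_nth_drop[of i xs] id_take_nth_drop[of "j - Suc i" "drop (Suc i) xs"] by simp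
    then show ?thesis
      using ij(3,4) unfolding P_def by blast
  qed
  then have P: "P (LEAST n. P n)" "\<And>n. P n \<Longrightarrow> (LEAST n. P n) \<le> n"
    by (auto intro: LeastI_ex Least_le)
  then obtain u a q b v where q: "xs = u @ a # q @ b # v" "same_stage a b" "b < a" "length q = (LEAST n. P n)"
    unfolding P_def[of "LEAST n. P n"] by blast
  have "\<not> same_stage a x" if "x \<in> set q" for x
  proof
    assume ax: "same_stage a x"
    obtain q1 q2 where q12: "q = q1 @ x # q2"
      using \<open>x \<in> set q\<close> by (meson split_list)
    show False
    proof (cases "x < a")
      case True
      then have "P (length q1)"
        using q(1) ax q12 unfolding P_def by (intro exI[of _ u] exI[of _ a] exI[of _ q1] exI[of _ x] exI[of _ "q2 @ b # v"]) auto
      then show False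
        using P(2)[of "length q1"] q(4) q12 by simp
    next
      case False
      have "same_stage x b"
        using ax q(2) same_stage_sym same_stage_trans by blast
      then have "P (length q2)"
        using q(1,3) False q12 unfolding P_def
        by (intro exI[of _ "u @ a # q1"] exI[of _ x] exI[of _ q2] exI[of _ b] exI[of _ v]) auto
      then show False
        using P(2)[of "length q2"] q(4) q12 by simp
    qed
  qed
  then show ?thesis
    using that q by blast
qed

text \<open>Neither word is a prefix of the other, so they part at a common vertex, and both next
  labels are branches of it.\<close>

lemma first_difference:
  assumes "l \<in> L" "l' \<in> L" "l \<noteq> l'"
  obtains p a r b r' where "l = p @ a # r" "l' = p @ b # r'" "a \<noteq> b" "same_stage a b"
proof -
  have "\<exists>p a r b r'. l = p @ a # r \<and> l' = p @ b # r' \<and> a \<noteq> b"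
    if "\<And>t. l' \<noteq> l @ t" "\<And>t. l \<noteq> l' @ t" for l l' :: "nat list"
    using that
  proof (induction l arbitrary: l')
    case Nil
    then show ?case
      using Nil.prems(1)[of l'] by simp
  next
    case (Cons x l)
    then obtain y m where l': "l' = y # m"
      by (cases l') auto
    show ?case
    proof (cases "x = y")
      case True
      then obtain p a r b r' where "l = p @ a # r" "m = p @ b # r'" "a \<noteq> b"
        using Cons.IH[of m] Cons.prems l' by auto
      then show ?thesis
        using True l' by (intro exI[of _ "x # p"]) auto
    next
      case False
      then show ?thesis
        using l' by (intro exI[of _ "[]"]) auto
    qed
  qed
  then obtain p a r b r' where "l = p @ a # r" "l' = p @ b # r'" "a \<noteq> b"
    using prefix_free assms by (metis append_Nil2)
  moreover have "same_stage a b"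
    using calculation assms unfolding same_stage_def branches_def by blast
  ultimately show ?thesis
    using that by blast
qed

text \<open>Two different words part at labels of one stage, whose order is fixed by the condition
  across words. Hence an ordered tuple can be recovered from its multiset.\<close>

lemma sorted_if_ordered:
  "set ls \<subseteq> L \<Longrightarrow> ordered (concat ls) \<Longrightarrow> sorted ls"
proof (induction ls)
  case Nil
  then show ?case by simp
next
  case (Cons x ls)
  have "x \<le> y" if y: "y \<in> set ls" for y
  proof (cases "x = y")
    case False
    have "x \<in> L" "y \<in> L"
      using Cons.prems(1) y by auto
    then obtain p a r b r' where *: "x = p @ a # r" "y = p @ b # r'" "a \<noteq> b" "same_stage a b"
      using False by (rule first_difference)
    have "cross x y"
      using Cons.prems(2)[unfolded ordered_concat] y by simp
    then have "a < b"
      using * by (auto simp: cross_def)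
    then show ?thesis
      using * by (simp add: order_less_imp_le)
  qed simp
  moreover have "ordered (concat ls)"
    using Cons.prems(2)[unfolded ordered_concat] unfolding ordered_concat by simp
  ultimately show ?case
    using Cons by simp
qed

lemma concat_first_difference:
  assumes "length ls = length ls'" "set ls \<subseteq> L" "set ls' \<subseteq> L" "ls \<noteq> ls'"
  shows "\<exists>u a r b r'. concat ls = u @ a # r \<and> concat ls' = u @ b # r' \<and> a \<noteq> b \<and> same_stage a b"
  using assms
proof (induction ls ls' rule: list_induct2)
  case Nil
  then show ?case by simp
next
  case (Cons l ls l' ls')
  have L: "l \<in> L" "l' \<in> L"
    using Cons.prems by auto
  show ?case
  proof (cases "l = l'")
    case True
    then obtain u a r b r' where "concat ls = u @ a # r" "concat ls' = u @ b # r'" "a \<noteq> b" "same_stage a b"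
      using Cons.IH Cons.prems by auto
    then show ?thesis
      using True by (intro exI[of _ "l @ u"] exI[of _ a] exI[of _ r] exI[of _ b] exI[of _ r']) simp
  next
    case False
    obtain p a r b r' where "l = p @ a # r" "l' = p @ b # r'" "a \<noteq> b" "same_stage a b"
      using L False by (rule first_difference)
    then show ?thesis
      by (intro exI[of _ p] exI[of _ a] exI[of _ "r @ concat ls"] exI[of _ b] exI[of _ "r' @ concat ls'"]) simp
  qed
qed

text \<open>At the first difference each of the two labels still occurs later in the other
  concatenation, so both inequalities between them follow.\<close>

lemma ordered_unique:
  assumes "set ls \<subseteq> L" "set ls' \<subseteq> L" "length ls = length ls'" "mset (concat ls) = mset (concat ls')"
    and ord: "ordered (concat ls)" "ordered (concat ls')"
  shows "ls = ls'"
proof (rule ccontr)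
  assume "ls \<noteq> ls'"
  then obtain u a r b r' where *: "concat ls = u @ a # r" "concat ls' = u @ b # r'" "a \<noteq> b" "same_stage a b"
    using concat_first_difference[OF assms(3,1,2)] by blast
  then have "add_mset a (mset r) = add_mset b (mset r')"
    using assms(4) by simp
  then have "b \<in> set r" "a \<in> set r'"
    using *(3) by (metis insert_iff set_mset_add_mset_insert set_mset_mset)+
  then have "a \<le> b" "b \<le> a"
    using ord * same_stage_sym by (auto simp: ordered_def sorted_wrt_append)
  then show False
    using *(3) by simp
qed

text \<open>The inversion lies within one word or across two, and the matching swap applies. It puts
  the smaller label at the earlier place and leaves everything before it unchanged, so the tuple
  gets smaller.\<close>

lemma swap_smaller:
  assumes "set ls \<subseteq> L" "\<not> ordered (concat ls)"
  shows "\<exists>ls'. length ls' = length ls \<and> set ls' \<subseteq> L \<and> mset (concat ls') = mset (concat ls) \<and> ls' < ls"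
proof -
  obtain u a q b v where bad: "concat ls = u @ a # q @ b # v" "same_stage a b" "b < a"
    "\<And>x. x \<in> set q \<Longrightarrow> \<not> same_stage a x"
    using not_orderedE[OF assms(2)] by blast
  obtain A p s C where ls: "ls = A @ (p @ a # s) # C" "q @ b # v = s @ concat C"
    using concat_eq_append_Cons[OF bad(1)] by blast
  from ls(2) consider t where "s = q @ b # t" | t where "q = s @ t" "concat C = t @ b # v"
    by (auto simp: append_eq_append_conv2 append_eq_Cons_conv Cons_eq_append_conv)
  then show ?thesis
  proof cases
    case (1 t)
    then obtain q' s' where "p @ b # q' @ a # s' \<in> L" "mset q' + mset s' = mset q + mset t"
      using swap_same[of p a q b t] bad assms(1) ls(1) by auto
    then show ?thesis
      using assms(1) bad(3) 1 unfolding ls(1)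
      by (intro exI[of _ "A @ (p @ b # q' @ a # s') # C"]) (auto simp: ac_simps)
  next
    case (2 t)
    then obtain B p' s' D where C: "C = B @ (p' @ b # s') # D"
      using concat_eq_append_Cons[of C t b v] by blast
    then obtain r r' where "p @ b # r \<in> L" "p' @ a # r' \<in> L" "mset r + mset r' = mset s + mset s'"
      using swap_different[of p a s p' b s'] bad assms(1) ls(1) by auto
    then show ?thesis
      using assms(1) bad(3) unfolding ls(1) C
      by (intro exI[of _ "A @ (p @ b # r) # B @ (p' @ a # r') # D"]) (auto simp: ac_simps)
  qed
qed

lemma ordered_exists:
  assumes "set ls \<subseteq> L"
  shows "\<exists>ls'. length ls' = length ls \<and> set ls' \<subseteq> L \<and> mset (concat ls') = mset (concat ls) \<and>
    ordered (concat ls') \<and> ls' \<le> ls"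
proof -
  let ?S = "{ls'. length ls' = length ls \<and> set ls' \<subseteq> L \<and> mset (concat ls') = mset (concat ls)}"
  have fin: "finite ?S"
    by (rule finite_subset[OF _ finite_lists_length_eq[OF finite_words, of "length ls"]]) auto
  have "ls \<in> ?S"
    using assms by simp
  then have "Min ?S \<in> ?S" and le: "Min ?S \<le> ls"
    using fin Min_in[OF fin] by (blast, simp)
  moreover have "ordered (concat (Min ?S))"
  proof (rule ccontr)
    assume "\<not> ?thesis"
    then obtain ls' where "ls' \<in> ?S" "ls' < Min ?S"
      using swap_smaller[of "Min ?S"] \<open>Min ?S \<in> ?S\<close> by auto
    then show False
      using Min_le[OF fin, of ls'] by simp
  qed
  ultimately show ?thesis
    by blast
qed

text \<open>Multisets carry no order while \<open>cross\<close> depends on it; as ordered tuples are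
  sorted, \<open>min\<close> and \<open>max\<close> restore the order without loss.\<close>

definition good :: "nat list \<Rightarrow> nat list \<Rightarrow> bool" where
  "good x y \<longleftrightarrow> cross (min x y) (max x y)"

lemma normal_iff:
  "normal {x \<in> L. ordered x} good \<alpha> \<longleftrightarrow>
     set_mset \<alpha> \<subseteq> L \<and> ordered (concat (sorted_list_of_multiset \<alpha>))"
  using pairs_iff_sorted_wrt[of "sorted_list_of_multiset \<alpha>" cross]
  by (auto simp: normal_def good_def ordered_concat)

text \<open>Only ordered words serve as letters: any other word shares its monomial with an ordered
  one and, being a single letter, would count as a second normal form.\<close>

lemma quadratic_monoid_words:
  assumes "\<And>\<alpha> \<beta>. set_mset \<alpha> \<subseteq> L \<Longrightarrow> set_mset \<beta> \<subseteq> L \<Longrightarrow>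
      (\<Sum>x\<in>#\<alpha>. g x) = (\<Sum>x\<in>#\<beta>. g x) \<longleftrightarrow>
      size \<alpha> = size \<beta> \<and> (\<Sum>x\<in>#\<alpha>. mset x) = (\<Sum>x\<in>#\<beta>. mset x)"
  shows "quadratic_monoid {x \<in> L. ordered x} g good"
proof
  have mset_concat: "mset (concat (sorted_list_of_multiset \<alpha>)) = (\<Sum>x\<in>#\<alpha>. mset x)" for \<alpha> :: "nat list multiset"
    by (metis mset_concat mset_map mset_sorted_list_of_multiset sum_mset_sum_list)
  have length: "length (sorted_list_of_multiset \<alpha>) = size \<alpha>" for \<alpha> :: "nat list multiset"
    by (metis mset_sorted_list_of_multiset size_mset)
  show "finite {x \<in> L. ordered x}"
    using finite_words by simp
  show "good y x" if "good x y" for x y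
    using that by (simp add: good_def min.commute max.commute)
  show "\<alpha> = \<beta>" if "normal {x \<in> L. ordered x} good \<alpha>" "normal {x \<in> L. ordered x} good \<beta>"
    "(\<Sum>x\<in>#\<alpha>. g x) = (\<Sum>x\<in>#\<beta>. g x)" for \<alpha> \<beta>
  proof -
    have "sorted_list_of_multiset \<alpha> = sorted_list_of_multiset \<beta>"
      using that assms[of \<alpha> \<beta>] by (intro ordered_unique) (auto simp: normal_iff length mset_concat)
    then show ?thesis
      by (metis mset_sorted_list_of_multiset)
  qed
  fix \<alpha> assume "set_mset \<alpha> \<subseteq> {x \<in> L. ordered x}"
  then have \<alpha>: "set_mset \<alpha> \<subseteq> L"
    by blast
  then obtain ls where ls: "length ls = size \<alpha>" "set ls \<subseteq> L" "mset (concat ls) = (\<Sum>x\<in>#\<alpha>. mset x)"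
    "ordered (concat ls)" "ls \<le> sorted_list_of_multiset \<alpha>"
    using ordered_exists[of "sorted_list_of_multiset \<alpha>"] by (auto simp: length mset_concat)
  have s: "sort ls = ls"
    using sorted_if_ordered[OF ls(2,4)] by (rule sorted_sort_id)
  have "normal {x \<in> L. ordered x} good (mset ls)"
    using ls by (simp add: normal_iff s)
  moreover have "(\<Sum>x\<in>#mset ls. g x) = (\<Sum>x\<in>#\<alpha>. g x)"
    using assms[of "mset ls" \<alpha>] ls \<alpha> mset_concat[of "mset ls"] by (simp add: s)
  moreover have "mset ls = \<alpha> \<or> mset_less (mset ls) \<alpha>"
    using ls(1,5) by (auto simp: mset_less_def s order_le_less)
  ultimately show "\<exists>\<beta>. normal {x \<in> L. ordered x} good \<beta> \<and> (\<Sum>x\<in>#\<beta>. g x) = (\<Sum>x\<in>#\<alpha>. g x) \<and>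
      (\<beta> = \<alpha> \<or> mset_less \<beta> \<alpha>)"
    by blast
qed

end

section \<open>Staged trees\<close>

context staged_tree
begin

section \<open>Walks in the tree\<close>

lemma awalk_append: "awalk u (p @ q) v \<longleftrightarrow> (\<exists>w. awalk u p w \<and> awalk w q v)"
  by (auto intro: awalk_appendI)

text \<open>A closed walk could be appended to the walk from the root, contradicting
  uniqueness.\<close>

lemma closed_awalk_Nil:
  assumes "awalk v c v"
  shows "c = []"
proof -
  have "v \<in> verts T"
    using assms by auto
  then obtain p where p: "awalk r p v" "\<And>q. awalk r q v \<Longrightarrow> q = p"
    using unique_walk by metis
  have "awalk r (p @ c) v"
    using p(1) assms by (rule awalk_appendI)
  then show ?thesis
    using p(2)[of "p @ c"] by simp
qed

text \<open>A repeated edge would give a nonempty closed walk. Hence products over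
  \<open>set p\<close> count every edge of a path once.\<close>

lemma distinct_awalk: "awalk u p v \<Longrightarrow> distinct p"
proof (rule ccontr)
  assume "awalk u p v" "\<not> distinct p"
  then obtain p1 e p2 p3 where "awalk u (p1 @ [e] @ p2 @ [e] @ p3) v"
    using not_distinct_decomp by blast
  then obtain w where "awalk w (([e] @ p2) @ ([e] @ p3)) v"
    unfolding awalk_append[of u p1] append_assoc by blast
  then obtain z where z: "awalk w ([e] @ p2) z" "awalk z ([e] @ p3) v"
    unfolding awalk_append[of w] by blast
  then have "w = tail T e" "z = tail T e"
    by (simp_all add: awalk_Cons_iff)
  then have "awalk (tail T e) ([e] @ p2) (tail T e)"
    using z(1) by simp
  then show False
    using closed_awalk_Nil by blast
qed

abbreviation leaf_paths :: "'v \<Rightarrow> 'e list set" where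
  "leaf_paths \<equiv> paths_to_leaves T"

lemma leaf_paths_iff: "p \<in> leaf_paths v \<longleftrightarrow> (\<exists>l\<in>verts T. out_arcs T l = {} \<and> awalk v p l)"
  by (simp add: paths_to_leaves_def)

lemma leaf_paths_distinct: "p \<in> leaf_paths v \<Longrightarrow> distinct p \<and> set p \<subseteq> arcs T"
  using distinct_awalk by (auto simp: leaf_paths_iff)

lemma finite_leaf_paths: "finite (leaf_paths v)"
  by (rule finite_subset[OF _ finite_subset_distinct[OF finite_arcs]]) (auto dest: leaf_paths_distinct)

text \<open>Walks never repeat an edge, so a longest one from \<open>v\<close> exists, and it must
  end in a leaf.\<close>

lemma leaf_paths_nonempty:
  assumes "v \<in> verts T"
  shows "leaf_paths v \<noteq> {}"
proof -
  let ?S = "{p. \<exists>w. awalk v p w}"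
  have fin: "finite ?S"
    by (rule finite_subset[OF _ finite_subset_distinct[OF finite_arcs]]) (auto dest: distinct_awalk)
  have "[] \<in> ?S"
    using assms by (auto simp: awalk_simps)
  then have "Max (length ` ?S) \<in> length ` ?S"
    using fin by (intro Max_in) auto
  then obtain p where p: "p \<in> ?S" "length p = Max (length ` ?S)"
    by force
  have max: "length q \<le> length p" if "q \<in> ?S" for q
    unfolding p(2) using fin that by (intro Max_ge) auto
  from p(1) obtain w where w: "awalk v p w" by blast
  have "out_arcs T w = {}"
  proof (rule ccontr)
    assume "out_arcs T w \<noteq> {}"
    then obtain e where "e \<in> arcs T" "tail T e = w"
      by (auto simp: out_arcs_def)
    then have "awalk w [e] (head T e)"
      by (auto simp: awalk_simps)
    with w have "awalk v (p @ [e]) (head T e)"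
      by (rule awalk_appendI)
    then show False
      using max[of "p @ [e]"] by (simp del: awalk_append_iff) blast
  qed
  then have "p \<in> leaf_paths v"
    using w awalk_last_in_verts[OF w] by (auto simp: leaf_paths_iff)
  then show ?thesis
    by blast
qed

lemma leaf_paths_Cons: "e # q \<in> leaf_paths v \<longleftrightarrow> e \<in> out_arcs T v \<and> q \<in> leaf_paths (head T e)"
  by (auto simp: leaf_paths_iff awalk_simps)

text \<open>
  Labels are coded by natural numbers because stages must be ordered and because polynomial rings
  are only known to be domains for linearly ordered variables.
\<close>

definition code :: "'l \<Rightarrow> nat" where
  "code = (SOME f. inj_on f (\<theta> ` arcs T))"

lemma inj_code: "inj_on code (\<theta> ` arcs T)"
proof -
  have "\<exists>f :: 'l \<Rightarrow> nat. inj_on f (\<theta> ` arcs T)"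
    using finite_imp_inj_to_nat_seg[of "\<theta> ` arcs T"] finite_arcs by blast
  then show ?thesis
    unfolding code_def by (rule someI_ex)
qed

section \<open>The language of label words of a tree\<close>

definition word :: "'e list \<Rightarrow> nat list" where
  "word p = map (\<lambda>e. code (\<theta> e)) p"

lemma word_simps [simp]: "word [] = []" "word (e # p) = code (\<theta> e) # word p" "word (p @ q) = word p @ word q"
  "length (word p) = length p"
  by (simp_all add: word_def)

lemma code_label_inj:
  "e \<in> out_arcs T v \<Longrightarrow> f \<in> out_arcs T v \<Longrightarrow> v \<in> verts T \<Longrightarrow> code (\<theta> e) = code (\<theta> f) \<Longrightarrow> e = f"
  using inj_code labels_inj[of v] by (auto simp: inj_on_def)

text \<open>Labels are distinct among the edges out of one vertex, so each letter determines the
  next edge.\<close>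

lemma word_inj: "awalk u p v \<Longrightarrow> awalk u q w \<Longrightarrow> word p = word q \<Longrightarrow> p = q"
proof (induction p arbitrary: u q)
  case Nil
  then show ?case by (simp add: word_def)
next
  case (Cons e p)
  then obtain f q' where q: "q = f # q'"
    by (cases q) auto
  have "e \<in> out_arcs T u" "f \<in> out_arcs T u" "u \<in> verts T"
    using Cons.prems by (auto simp: q awalk_simps)
  then have "e = f"
    using code_label_inj Cons.prems(3) by (simp add: q)
  then show ?case
    using Cons by (auto simp: q awalk_simps)
qed

definition language :: "nat list set" where
  "language = word ` leaf_paths r"

lemma awalk_prefix_word:
  assumes "awalk u p v" "awalk u q w" "word q = word p @ x"
  obtains q' where "q = p @ q'" "awalk v q' w" "x = word q'"
proof -
  have len: "length p \<le> length q"
    using arg_cong[OF assms(3), of length] by simp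
  define q1 q2 where "q1 = take (length p) q" and "q2 = drop (length p) q"
  have q: "q = q1 @ q2"
    by (simp add: q1_def q2_def)
  have "length (word q1) = length (word p)"
    using len by (simp add: q1_def)
  then have eq: "word q1 = word p" "word q2 = x"
    using assms(3) by (auto simp: q)
  obtain z where z: "awalk u q1 z" "awalk z q2 w"
    using assms(2) unfolding q awalk_append by blast
  then have "q1 = p"
    using word_inj[OF z(1) assms(1) eq(1)] by simp
  moreover have "z = v"
    using z(1) assms(1) \<open>q1 = p\<close> by (metis awalkE')
  ultimately show ?thesis
    using that[of q2] q z eq by simp
qed

lemma rest_word:
  assumes "awalk r p v"
  shows "rest language (word p) = word ` leaf_paths v"
proof (intro equalityI subsetI)
  fix x assume "x \<in> rest language (word p)"
  then obtain q l where q: "word q = word p @ x" "l \<in> verts T" "out_arcs T l = {}" "awalk r q l"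
    by (auto simp: rest_def language_def leaf_paths_iff image_iff)
  then obtain q' where "awalk v q' l" "x = word q'"
    using awalk_prefix_word[OF assms q(4,1)] by blast
  moreover from this have "q' \<in> leaf_paths v"
    using q(2,3) by (auto simp: leaf_paths_iff)
  ultimately show "x \<in> word ` leaf_paths v"
    by blast
next
  fix x assume "x \<in> word ` leaf_paths v"
  then obtain q l where q: "x = word q" "l \<in> verts T" "out_arcs T l = {}" "awalk v q l"
    by (auto simp: leaf_paths_iff)
  then have "p @ q \<in> leaf_paths r"
    using assms by (auto simp: leaf_paths_iff intro: awalk_appendI)
  then have "word (p @ q) \<in> language"
    unfolding language_def by (rule imageI)
  then show "x \<in> rest language (word p)"
    using q(1) by (simp add: rest_def)
qed

lemma branches_eq_rest: "branches L x = {a. \<exists>q. a # q \<in> rest L x}"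
  by (simp add: branches_def rest_def)

lemma branches_word:
  assumes "awalk r p v"
  shows "branches language (word p) = (\<lambda>e. code (\<theta> e)) ` out_arcs T v"
proof (intro equalityI subsetI)
  fix a assume "a \<in> branches language (word p)"
  then obtain q x where "q \<in> leaf_paths v" "a # x = word q"
    by (auto simp: branches_eq_rest rest_word[OF assms])
  then show "a \<in> (\<lambda>e. code (\<theta> e)) ` out_arcs T v"
    by (cases q) (auto simp: leaf_paths_Cons)
next
  fix a assume "a \<in> (\<lambda>e. code (\<theta> e)) ` out_arcs T v"
  then obtain e where e: "e \<in> out_arcs T v" "a = code (\<theta> e)"
    by blast
  then obtain q where "q \<in> leaf_paths (head T e)"
    using leaf_paths_nonempty[of "head T e"] by (auto simp: out_arcs_def)
  then have "word (e # q) \<in> word ` leaf_paths v"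
    using e by (intro imageI) (simp add: leaf_paths_Cons)
  then show "a \<in> branches language (word p)"
    using e by (auto simp: branches_eq_rest rest_word[OF assms])
qed

lemma branches_prefix:
  assumes "a \<in> branches language x"
  obtains p v where "awalk r p v" "v \<in> verts T" "x = word p"
proof -
  obtain y q l where q: "word q = x @ y" "awalk r q l"
    using assms by (auto simp: branches_def language_def leaf_paths_iff) metis
  have "word (take (length x) q) = x"
    using arg_cong[OF q(1), of "take (length x)"] by (simp add: word_def take_map)
  moreover have "awalk r (take (length x) q @ drop (length x) q) l"
    using q(2) by simp
  then obtain v where "awalk r (take (length x) q) v"
    unfolding awalk_append by blast
  ultimately show ?thesis
    using that by (metis awalkE')
qed

lemma t_poly_eq_word_sum:
  assumes "v \<in> verts T"
  shows "t_poly T \<theta> v = word_sum (map \<theta> ` leaf_paths v)"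
proof -
  have "inj_on (map \<theta>) (leaf_paths v)"
  proof (rule inj_onI)
    fix p q assume "p \<in> leaf_paths v" "q \<in> leaf_paths v" "map \<theta> p = map \<theta> q"
    moreover from this(3) have "word p = word q"
      by (metis word_def map_map[unfolded o_def])
    ultimately show "p = q"
      using word_inj by (auto simp: leaf_paths_iff)
  qed
  moreover have "(\<Prod>e\<in>set p. pvar (\<theta> e)) = Poly_Mapping.single (expo (map \<theta> p)) 1"
    if "p \<in> leaf_paths v" for p
  proof -
    have "distinct p"
      using that leaf_paths_distinct by blast
    then show ?thesis
      by (induction p) (simp_all add: expo_def pvar_def mult_single)
  qed
  ultimately show ?thesis
    by (simp add: t_poly_def word_sum_def sum.reindex)
qed

lemma staged_language:
  assumes "balanced T S \<theta>"
  shows "staged_language language"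
proof
  show "finite language"
    by (simp add: language_def finite_leaf_paths)
  show "q = []" if p: "p \<in> language" and pq: "p @ q \<in> language" for p q
  proof -
    obtain w l where w: "p = word w" "awalk r w l" "out_arcs T l = {}"
      using p by (auto simp: language_def leaf_paths_iff)
    have "q \<in> rest language (word w)"
      using pq w(1) by (simp add: rest_def)
    then obtain z where "z \<in> leaf_paths l" "q = word z"
      unfolding rest_word[OF w(2)] by blast
    then show ?thesis
      using w(3) by (cases z) (auto simp: leaf_paths_Cons)
  qed
  have stage: "(u, v) \<in> S" if "u \<in> verts T" "v \<in> verts T"
    and a: "a \<in> (\<lambda>e. code (\<theta> e)) ` out_arcs T u" "a \<in> (\<lambda>e. code (\<theta> e)) ` out_arcs T v" for a u v
  proof (rule ccontr)
    assume "(u, v) \<notin> S"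
    obtain e f where ef: "e \<in> out_arcs T u" "f \<in> out_arcs T v" "code (\<theta> e) = code (\<theta> f)"
      using a by auto
    then have "\<theta> e = \<theta> f"
      using inj_code by (auto simp: inj_on_def)
    then show False
      using different_stage[OF that(1,2) _ _ \<open>(u, v) \<notin> S\<close>] ef by blast
  qed
  show "branches language p = branches language q"
    if ap: "a \<in> branches language p" and aq: "a \<in> branches language q" for a p q
  proof -
    obtain x u where x: "awalk r x u" "u \<in> verts T" "p = word x"
      using ap by (rule branches_prefix)
    obtain y v where y: "awalk r y v" "v \<in> verts T" "q = word y"
      using aq by (rule branches_prefix)
    have a: "a \<in> (\<lambda>e. code (\<theta> e)) ` out_arcs T u" "a \<in> (\<lambda>e. code (\<theta> e)) ` out_arcs T v"
      using ap aq branches_word[OF x(1)] branches_word[OF y(1)] x y by simp_all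
    then have "\<theta> ` out_arcs T u = \<theta> ` out_arcs T v"
      using stage[OF x(2) y(2) a] by (intro same_stage x y) auto
    then have "code ` \<theta> ` out_arcs T u = code ` \<theta> ` out_arcs T v"
      by simp
    then show ?thesis
      using branches_word[OF x(1)] branches_word[OF y(1)] x(3) y(3) by (simp add: image_image)
  qed
  show "word_sum (rest language (p @ [a])) * word_sum (rest language (q @ [b])) =
      word_sum (rest language (p @ [b])) * word_sum (rest language (q @ [a]))"
    if eq: "branches language p = branches language q"
      and a: "a \<in> branches language p" and b: "b \<in> branches language p" for p q a b
  proof -
    obtain x u where x: "awalk r x u" "u \<in> verts T" "p = word x"
      using a by (rule branches_prefix)
    obtain y v where y: "awalk r y v" "v \<in> verts T" "q = word y"
      using a[unfolded eq] by (rule branches_prefix)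
    have au: "a \<in> (\<lambda>e. code (\<theta> e)) ` out_arcs T u" "a \<in> (\<lambda>e. code (\<theta> e)) ` out_arcs T v"
      and bu: "b \<in> (\<lambda>e. code (\<theta> e)) ` out_arcs T u" "b \<in> (\<lambda>e. code (\<theta> e)) ` out_arcs T v"
      using a b eq branches_word[OF x(1)] branches_word[OF y(1)] x y by simp_all
    obtain ei ej where e: "ei \<in> out_arcs T u" "ej \<in> out_arcs T u" "code (\<theta> ei) = a" "code (\<theta> ej) = b"
      using au(1) bu(1) by auto
    obtain fi fj where f: "fi \<in> out_arcs T v" "fj \<in> out_arcs T v" "code (\<theta> fi) = a" "code (\<theta> fj) = b"
      using au(2) bu(2) by auto
    have "\<theta> ei = \<theta> fi" "\<theta> ej = \<theta> fj"
      using e f inj_code by (auto simp: inj_on_def)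
    then have "t_poly T \<theta> (head T ei) * t_poly T \<theta> (head T fj) =
        t_poly T \<theta> (head T ej) * t_poly T \<theta> (head T fi)"
      using assms stage[OF x(2) y(2) au] e(1,2) f(1,2) unfolding balanced_def by blast
    moreover have heads: "head T ei \<in> verts T" "head T ej \<in> verts T" "head T fi \<in> verts T" "head T fj \<in> verts T"
      using e f by (auto simp: out_arcs_def)
    ultimately have labels: "word_sum (map \<theta> ` leaf_paths (head T ei)) * word_sum (map \<theta> ` leaf_paths (head T fj)) =
        word_sum (map \<theta> ` leaf_paths (head T ej)) * word_sum (map \<theta> ` leaf_paths (head T fi))"
      by (simp add: t_poly_eq_word_sum)
    \<comment> \<open>The balance identity is now known for the original labels;
      \<open>word_sum_map\<close> carries it over to their codes, \<open>code\<close> being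
      injective on the labels of the tree.\<close>
    have inj: "inj_on (map code) (map \<theta> ` leaf_paths (head T ei) \<union> map \<theta> ` leaf_paths (head T fj) \<union>
        map \<theta> ` leaf_paths (head T ej) \<union> map \<theta> ` leaf_paths (head T fi))" (is "inj_on _ ?M")
    proof (rule inj_on_mapI)
      have "\<Union>(set ` ?M) \<subseteq> \<theta> ` arcs T"
        using leaf_paths_distinct by fastforce
      then show "inj_on code (\<Union>(set ` ?M))"
        using inj_code by (rule inj_on_subset[rotated])
    qed
    have "word_sum (map code ` map \<theta> ` leaf_paths (head T ei)) * word_sum (map code ` map \<theta> ` leaf_paths (head T fj)) =
        word_sum (map code ` map \<theta> ` leaf_paths (head T ej)) * word_sum (map code ` map \<theta> ` leaf_paths (head T fi))"
      by (rule word_sum_map[OF labels _ _ _ _ inj]) (intro finite_imageI finite_leaf_paths)+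
    moreover have "map code ` map \<theta> ` P = word ` P" for P
      by (simp add: image_image word_def o_def)
    moreover have "rest language (word p @ [code (\<theta> e)]) = word ` leaf_paths (head T e)"
      if "awalk r p u" "e \<in> out_arcs T u" for p u e
    proof -
      have "awalk u [e] (head T e)"
        using that by (auto simp: awalk_simps out_arcs_def)
      from rest_word[OF awalk_appendI[OF that(1) this]] show ?thesis
        by simp
    qed
    ultimately show ?thesis
      using e f x y by simp metis
  qed
qed

section \<open>Exponents of path monomials\<close>

lemma tree_depth_eq: "tree_depth T r = Max (length ` language)"
proof -
  have "(\<lambda>p. card (set p)) ` leaf_paths r = length ` language"
    unfolding language_def image_image
    by (rule image_cong) (auto simp: distinct_card dest: leaf_paths_distinct)
  then show ?thesis
    by (simp add: tree_depth_def)
qed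

lemma root_language: "finite language" "language \<noteq> {}"
  using leaf_paths_nonempty[OF root_in_verts] by (auto simp: language_def finite_leaf_paths)

lemma length_le_depth: "x \<in> language \<Longrightarrow> length x \<le> tree_depth T r"
  unfolding tree_depth_eq using root_language by (intro Max_ge) auto

definition letter :: "nat \<Rightarrow> 'l tree_var" where
  "letter a = Theta (inv_into (\<theta> ` arcs T) code a)"

definition exponent :: "nat list \<Rightarrow> 'l tree_var \<Rightarrow>\<^sub>0 nat" where
  "exponent x = Poly_Mapping.single Z (tree_depth T r - length x) + expo (map letter x)"

lemma letter_code: "e \<in> arcs T \<Longrightarrow> letter (code (\<theta> e)) = Theta (\<theta> e)"
  using inj_code by (simp add: letter_def)

lemma letter_inj: "inj_on letter (code ` \<theta> ` arcs T)"
  by (auto simp: inj_on_def letter_code)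

lemma language_letters: "x \<in> language \<Longrightarrow> set x \<subseteq> code ` \<theta> ` arcs T"
  using leaf_paths_distinct by (fastforce simp: language_def word_def)

lemma path_monomial_eq:
  assumes "p \<in> leaf_paths r"
  shows "path_monomial T r \<theta> p = Poly_Mapping.single (exponent (word p)) 1"
proof -
  have p: "distinct p" "set p \<subseteq> arcs T"
    using leaf_paths_distinct[OF assms] by auto
  have "(\<Prod>e\<in>set p. pvar (Theta (\<theta> e))) = Poly_Mapping.single (expo (map letter (word p))) 1"
    using p by (induction p) (simp_all add: expo_def pvar_def mult_single letter_code)
  moreover have "pvar (Z :: 'l tree_var) ^ n = Poly_Mapping.single (Poly_Mapping.single Z n) 1" for n
    by (induction n) (simp_all add: pvar_def mult_single single_add[symmetric])
  ultimately show ?thesis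
    using p(1) by (simp add: path_monomial_def exponent_def mult_single distinct_card)
qed

lemma tree_algebra_eq:
  "tree_algebra T r \<theta> = algebra_generated ((\<lambda>x. Poly_Mapping.single (exponent x) 1) ` language)"
proof -
  have "path_monomial T r \<theta> ` leaf_paths r = (\<lambda>x. Poly_Mapping.single (exponent x) 1) ` language"
    unfolding language_def image_image by (rule image_cong) (simp_all add: path_monomial_eq)
  then show ?thesis
    by (simp add: tree_algebra_def)
qed

definition weight :: "('l tree_var \<Rightarrow>\<^sub>0 nat) \<Rightarrow> nat" where
  "weight \<alpha> = (\<Sum>x\<in>Poly_Mapping.keys \<alpha>. Poly_Mapping.lookup \<alpha> x)"

lemma weight_zero [simp]: "weight 0 = 0"
  and weight_single [simp]: "weight (Poly_Mapping.single x n) = n"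
  and weight_add: "weight (\<alpha> + \<beta>) = weight \<alpha> + weight \<beta>"
  using setsum_keys_plus_distrib[of "\<lambda>_ n. n" \<alpha> \<beta>] by (simp_all add: weight_def)

lemma weight_expo: "weight (expo q) = length q"
  by (induction q) (simp_all add: expo_def weight_add)

lemma weight_exponent: "x \<in> language \<Longrightarrow> weight (exponent x) = tree_depth T r"
  using length_le_depth by (simp add: exponent_def weight_add weight_expo)

lemma weight_sum:
  "set_mset \<alpha> \<subseteq> language \<Longrightarrow> weight (\<Sum>x\<in>#\<alpha>. exponent x) = size \<alpha> * tree_depth T r"
  by (induction \<alpha>) (auto simp: weight_add weight_exponent)

text \<open>The power of \<open>Z\<close> in a product is determined by the number of factors and
  their total length, so the product depends only on the number of words and their labels.\<close>

lemma sum_exponent: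
  assumes "set_mset \<alpha> \<subseteq> language" "mset q = (\<Sum>x\<in>#\<alpha>. mset x)"
  shows "(\<Sum>x\<in>#\<alpha>. exponent x) =
    Poly_Mapping.single Z (size \<alpha> * tree_depth T r - length q) + expo (map letter q)"
proof -
  have "(\<Sum>x\<in>#\<alpha>. exponent x) = (\<Sum>x\<in>#\<alpha>. Poly_Mapping.single Z (tree_depth T r - length x)) +
      (\<Sum>x\<in>#\<alpha>. expo (map letter x))"
    by (simp add: exponent_def sum_mset.distrib)
  also have "(\<Sum>x\<in>#\<alpha>. expo (map letter x)) = expo (map letter q)"
    using assms(2)
  proof (induction \<alpha> arbitrary: q)
    case empty
    then show ?case by simp
  next
    case (add x \<alpha>)
    obtain q' where q': "mset q' = (\<Sum>x\<in>#\<alpha>. mset x)"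
      using ex_mset by metis
    then have "expo (map letter q) = expo (map letter (x @ q'))"
      using add.prems by (simp only: expo_eq_iff) simp
    then show ?case
      using add.IH[OF q'] by (simp add: expo_append)
  qed
  also have "(\<Sum>x\<in>#\<alpha>. Poly_Mapping.single Z (tree_depth T r - length x)) =
      Poly_Mapping.single Z (\<Sum>x\<in>#\<alpha>. tree_depth T r - length x)"
    by (induction \<alpha>) (simp_all add: single_add)
  also have "(\<Sum>x\<in>#\<alpha>. tree_depth T r - length x) = size \<alpha> * tree_depth T r - length q"
  proof -
    \<comment> \<open>No word is longer than the depth, so the truncated subtractions are
      exact.\<close>
    have "(\<Sum>x\<in>#\<alpha>. tree_depth T r - length x) + (\<Sum>x\<in>#\<alpha>. length x) = size \<alpha> * tree_depth T r"
      using assms(1) by (induction \<alpha>) (auto dest: length_le_depth)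
    moreover have "length q = (\<Sum>x\<in>#\<alpha>. length x)"
    proof -
      have "size (\<Sum>x\<in>#\<alpha>. mset x) = (\<Sum>x\<in>#\<alpha>. length x)"
        by (induction \<alpha>) simp_all
      then show ?thesis
        using assms(2) by (metis size_mset)
    qed
    ultimately show ?thesis
      by simp
  qed
  finally show ?thesis .
qed

text \<open>Each exponent has total degree \<open>tree_depth T r\<close>, so for positive depth the
  total degree of the sum gives the number of words; the labels are read off the other variables, as
  \<open>letter\<close> is injective on codes.\<close>

lemma sum_exponent_eq_iff:
  assumes "set_mset \<alpha> \<subseteq> language" "set_mset \<beta> \<subseteq> language" "tree_depth T r \<noteq> 0"
  shows "(\<Sum>x\<in>#\<alpha>. exponent x) = (\<Sum>x\<in>#\<beta>. exponent x) \<longleftrightarrow>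
    size \<alpha> = size \<beta> \<and> (\<Sum>x\<in>#\<alpha>. mset x) = (\<Sum>x\<in>#\<beta>. mset x)"
proof
  obtain p q where p: "mset p = (\<Sum>x\<in>#\<alpha>. mset x)" and q: "mset q = (\<Sum>x\<in>#\<beta>. mset x)"
    using ex_mset by metis
  note sums = sum_exponent[OF assms(1) p] sum_exponent[OF assms(2) q]
  {
    assume eq: "(\<Sum>x\<in>#\<alpha>. exponent x) = (\<Sum>x\<in>#\<beta>. exponent x)"
    have size: "size \<alpha> = size \<beta>"
      using weight_sum[OF assms(1)] weight_sum[OF assms(2)] eq assms(3) by simp
    have letters: "set s \<subseteq> code ` \<theta> ` arcs T"
      if "mset s = (\<Sum>x\<in>#\<gamma>. mset x)" "set_mset \<gamma> \<subseteq> language" for s \<gamma>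
    proof
      fix b assume "b \<in> set s"
      then have "b \<in># (\<Sum>x\<in>#\<gamma>. mset x)"
        using that(1) by (metis set_mset_mset)
      then obtain x where "x \<in># \<gamma>" "b \<in> set x"
        by auto
      then show "b \<in> code ` \<theta> ` arcs T"
        using that(2) language_letters by blast
    qed
    have "count (mset p) a = count (mset q) a" for a
    proof (cases "a \<in> code ` \<theta> ` arcs T")
      case True
      have count: "Poly_Mapping.lookup (expo (map letter s)) (letter a) = count (mset s) a"
        if "set s \<subseteq> code ` \<theta> ` arcs T" for s
        using that
      proof (induction s)
        case (Cons b s)
        then show ?case
          using letter_inj True by (auto simp: lookup_expo inj_on_eq_iff)
      qed simp
      have "Poly_Mapping.lookup (expo (map letter p)) (letter a) = Poly_Mapping.lookup (expo (map letter q)) (letter a)"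
        using arg_cong[OF eq, of "\<lambda>k. Poly_Mapping.lookup k (letter a)"] unfolding sums
        by (simp add: lookup_add lookup_single letter_def)
      then show ?thesis
        using count letters p q assms(1,2) by simp
    next
      case False
      then have "a \<notin># mset p" "a \<notin># mset q"
        using letters[OF p assms(1)] letters[OF q assms(2)] by auto
      then show ?thesis
        by (metis not_in_iff)
    qed
    then show "size \<alpha> = size \<beta> \<and> (\<Sum>x\<in>#\<alpha>. mset x) = (\<Sum>x\<in>#\<beta>. mset x)"
      using size p q by (metis multiset_eqI)
  next
    assume "size \<alpha> = size \<beta> \<and> (\<Sum>x\<in>#\<alpha>. mset x) = (\<Sum>x\<in>#\<beta>. mset x)"
    then have "size \<alpha> = size \<beta>" "mset p = mset q"
      using p q by auto
    moreover from this have "expo (map letter p) = expo (map letter q)" "length p = length q"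
      by (auto simp: expo_eq_iff dest: mset_eq_length)
    ultimately show "(\<Sum>x\<in>#\<alpha>. exponent x) = (\<Sum>x\<in>#\<beta>. exponent x)"
      unfolding sums by simp
  }
qed

text \<open>Total degree is the depth times the number of letters of the normal form, so
  \<open>tree_grading\<close> agrees with \<open>component\<close>. At depth 0 total degree cannot
  separate the components, but without letters only degree 0 is left.\<close>

lemma koszul_if_quadratic_monoid:
  assumes "quadratic_monoid X exponent good" "X \<subseteq> language"
    and gen: "tree_algebra T r \<theta> = algebra_generated ((\<lambda>x. Poly_Mapping.single (exponent x) 1) ` X)"
    and empty: "tree_depth T r = 0 \<Longrightarrow> X = {}"
  shows "koszul (tree_algebra T r \<theta>) (tree_grading T r \<theta>)"
proof -
  interpret K: quadratic_monoid X exponent good by fact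
  have alg: "tree_algebra T r \<theta> = K.algebra"
    unfolding gen by (rule K.algebra_generated_letters)
  have weight: "weight h = size (K.nf h) * tree_depth T r" if "h \<in> K.H" for h
    using weight_sum[of "K.nf h"] K.nf_letters[OF that] assms(2) K.monom_nf[OF that] by (simp add: K.monom_def)
  have "size (K.nf h) = 0" if "h \<in> K.H" "tree_depth T r = 0" for h
    using K.nf_letters[OF that(1)] empty[OF that(2)] by simp
  then have "h \<in> K.H \<Longrightarrow> weight h = m * tree_depth T r \<and> (tree_depth T r = 0 \<longrightarrow> m = 0) \<longleftrightarrow> size (K.nf h) = m" for h m
    using weight by (cases "tree_depth T r = 0") auto
  then have "tree_grading T r \<theta> = K.component"
    unfolding tree_grading_def alg K.component_def K.algebra_def weight_def[symmetric]
    by (intro ext Collect_cong) blast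
  then show ?thesis
    using K.koszul_algebra alg by simp
qed

theorem koszul_tree_algebra:
  assumes "balanced T S \<theta>"
  shows "koszul (tree_algebra T r \<theta>) (tree_grading T r \<theta>)"
proof (cases "tree_depth T r = 0")
  case False
  interpret staged_language language
    by (rule staged_language[OF assms])
  have "quadratic_monoid {x \<in> language. ordered x} exponent good"
    using False by (intro quadratic_monoid_words sum_exponent_eq_iff)
  \<comment> \<open>Each path has an ordered path with the same monomial, so ordered words already
    generate the algebra.\<close>
  moreover have "exponent ` language = exponent ` {x \<in> language. ordered x}"
  proof (intro equalityI subsetI)
    fix k assume "k \<in> exponent ` language"
    then obtain x where x: "x \<in> language" "k = exponent x"
      by blast
    obtain ls where ls: "length ls = 1" "set ls \<subseteq> language" "mset (concat ls) = mset x" "ordered (concat ls)"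
      using ordered_exists[of "[x]"] x by auto
    then obtain y where y: "y \<in> language" "mset y = mset x" "ordered y"
      by (auto simp: length_Suc_conv)
    then have "exponent y = exponent x"
      using sum_exponent_eq_iff[of "{#y#}" "{#x#}"] x False by simp
    then show "k \<in> exponent ` {x \<in> language. ordered x}"
      using x y by (intro image_eqI[of _ _ y]) auto
  qed auto
  then have "(\<lambda>x. Poly_Mapping.single (exponent x) (1::real)) ` language =
      (\<lambda>x. Poly_Mapping.single (exponent x) 1) ` {x \<in> language. ordered x}"
    by (simp only: image_image[of "\<lambda>k. Poly_Mapping.single k 1" exponent, symmetric])
  ultimately show ?thesis
    using False by (intro koszul_if_quadratic_monoid) (auto simp: tree_algebra_eq)
next
  case True
  \<comment> \<open>The only path monomial is \<open>1\<close>, of degree 0, so there must be no generators in degree 1.\<close>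
  have "x = []" if "x \<in> language" for x
    using length_le_depth[OF that] True by simp
  then have lang: "language = {[]}"
    using root_language(2) by auto
  have "tree_algebra T r \<theta> = algebra_generated ((\<lambda>x. Poly_Mapping.single (exponent x) 1) ` {})"
  proof -
    have "exponent [] = 0"
      using True by (simp add: exponent_def)
    moreover have "subalgebra hull {1} = subalgebra hull ({} :: (('l tree_var \<Rightarrow>\<^sub>0 nat) \<Rightarrow>\<^sub>0 real) set)"
    proof -
      have "subalgebra t \<and> {1} \<subseteq> t \<longleftrightarrow> subalgebra t \<and> {} \<subseteq> t" for t :: "(('l tree_var \<Rightarrow>\<^sub>0 nat) \<Rightarrow>\<^sub>0 real) set"
        by (auto simp: subalgebra_def)
      then show ?thesis
        unfolding hull_def by presburger
    qed
    ultimately show ?thesis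
      by (simp add: tree_algebra_eq lang algebra_generated_def)
  qed
  moreover have "quadratic_monoid {} exponent (\<lambda>_ _. True)"
    by standard (auto simp: normal_def)
  ultimately show ?thesis
    using True by (intro koszul_if_quadratic_monoid) auto
qed

end

theorem corollary3p8:
  fixes T :: "('v, 'e) pre_digraph" and r :: 'v
    and S :: "('v \<times> 'v) set" and \<theta> :: "'e \<Rightarrow> 'l"
  assumes "staged_tree T r S \<theta>"
    and "balanced T S \<theta>"
  shows "koszul (tree_algebra T r \<theta>) (tree_grading T r \<theta>)"
  using staged_tree.koszul_tree_algebra[OF assms] .

end
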